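(* Suppose that $h\in C_0^\infty(\mathbb R_+)'$ and that there is a constant $C$ with $$|\langle h,\bar f\star f\rangle|\le C\|f\|^2_{L^2(\mathbb R_+)}\qquad\text{for all } f\in C_0^\infty(\mathbb R_+).$$ Then for an arbitrary $\kappa>2$ there is a constant $C_\kappa$ such that $$|\langle h,F\rangle|\le C_\kappa\sum_{n=0}^2\max_{t\in\mathbb R_+}\big((1+|\ln t|)^\kappa t^n|F^{(n)}(t)|\big)\qquad\text{for all }F\in C_0^\infty(\mathbb R_+).$$ In particular, $h\in\mathcal Z_+'$.
   Context: $\mathbb R_+=(0,\infty)$. For a topological vector space $\mathcal L$, $\mathcal L'$ is the space of continuous antilinear functionals; brackets $\langle\cdot,\cdot\rangle$ are linear in the first and antilinear in the second argument. The Laplace convolution is $(\bar f_1\star f_2)(t)=\int_0^t\overline{f_1(s)}f_2(t-s)ds$. $\mathcal Z$ is the set of Schwartz functions $\varphi$ on $\mathbb R$ that extend to entire functions with $|\varphi(z)|\le C_n(1+|z|)^{-n}e^{r|\operatorname{Im}z|}$ for all $n$ and some $r=r(\varphi)>0$ (equivalently, $\mathcal Z$ is the image of $C_0^\infty(\mathbb R)$ under the Fourier transform, with the corresponding topology). $\mathcal Z_+$ is the set of functions $F$ on $\mathbb R_+$ such that $\Omega(x)=F(e^x)$ belongs to $\mathcal Z$ (with the transferred topology), and $\mathcal Z_+'$ is its dual. Thus $h\in\mathcal Z_+'$ if and only if the distribution $\theta(x)=e^xh(e^x)$, defined by $\langle\theta,\Omega\rangle=\langle h,F\rangle$ for $\Omega(x)=F(e^x)$,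 belongs to $\mathcal Z'$. For a distribution $h\in C_0^\infty(\mathbb R_+)'$, the conclusion $h\in\mathcal Z_+'$ is meant in the sense that $\theta\in C_0^\infty(\mathbb R)'$ extends to an element of the space $\mathcal S(\mathbb R)'$ of tempered distributions, and $\mathcal S(\mathbb R)'\subset\mathcal Z'$. *)

theory Defs
  imports "HOL-Analysis.Analysis"
begin

text \<open>
  A function on the half-line is represented by a function on the real line that vanishes on
  \<open>{..0}\<close>.
\<close>

definition nderiv :: "nat \<Rightarrow> (real \<Rightarrow> complex) \<Rightarrow> real \<Rightarrow> complex" where
  "nderiv n f = ((\<lambda>g x. vector_derivative g (at x)) ^^ n) f"

definition smooth :: "(real \<Rightarrow> complex) \<Rightarrow> bool" where
  "smooth f \<longleftrightarrow> (\<forall>n x. nderiv n f differentiable (at x))"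

definition supp :: "(real \<Rightarrow> complex) \<Rightarrow> real set" where
  "supp f = closure {x. f x \<noteq> 0}"

definition seminorm_on :: "(real \<Rightarrow> complex) set \<Rightarrow> ((real \<Rightarrow> complex) \<Rightarrow> real) \<Rightarrow> bool" where
  "seminorm_on X p \<longleftrightarrow>
     (\<forall>f\<in>X. \<forall>g\<in>X. p (\<lambda>x. f x + g x) \<le> p f + p g) \<and>
     (\<forall>c. \<forall>f\<in>X. p (\<lambda>x. c * f x) = cmod c * p f)"

definition lc_topology ::
  "(real \<Rightarrow> complex) set \<Rightarrow> ((real \<Rightarrow> complex) \<Rightarrow> real) set \<Rightarrow> (real \<Rightarrow> complex) topology" where
  "lc_topology X P =
     topology_generated_by {{g \<in> X. p (\<lambda>x. g x - f x) < e} | p f e. p \<in> P \<and> f \<in> X \<and> 0 < e}"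

definition antidual :: "(real \<Rightarrow> complex) topology \<Rightarrow> ((real \<Rightarrow> complex) \<Rightarrow> complex) set" where
  "antidual T = {h.
     (\<forall>f\<in>topspace T. \<forall>g\<in>topspace T. h (\<lambda>x. f x + g x) = h f + h g) \<and>
     (\<forall>c. \<forall>f\<in>topspace T. h (\<lambda>x. c * f x) = cnj c * h f) \<and>
     continuous_map T euclidean h}"

definition test_space :: "real set \<Rightarrow> (real \<Rightarrow> complex) set" where
  "test_space U = {f. smooth f \<and> compact (supp f) \<and> supp f \<subseteq> U}"

text \<open>
  The inductive limit topology of \<open>test_space U\<close> is the finest locally convex topology for which
  the inclusions of the Frechet spaces of test functions supported in a fixed compact \<open>K \<subseteq> U\<close> are
  continuous. It is therefore generated by all seminorms whose restriction to each of these
  spaces is continuous.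
\<close>

definition test_seminorms :: "real set \<Rightarrow> ((real \<Rightarrow> complex) \<Rightarrow> real) set" where
  "test_seminorms U = {p. seminorm_on (test_space U) p \<and>
     (\<forall>K. compact K \<and> K \<subseteq> U \<longrightarrow>
       (\<exists>C N. \<forall>f\<in>test_space U. supp f \<subseteq> K \<longrightarrow>
          p f \<le> C * (\<Sum>n\<le>N. SUP x. cmod (nderiv n f x))))}"

definition test_topology :: "real set \<Rightarrow> (real \<Rightarrow> complex) topology" where
  "test_topology U = lc_topology (test_space U) (test_seminorms U)"

definition schwartz_space :: "(real \<Rightarrow> complex) set" where
  "schwartz_space =
     {f. smooth f \<and> (\<forall>j k. bdd_above (range (\<lambda>x. \<bar>x\<bar> ^ j * cmod (nderiv k f x))))}"

definition schwartz_topology :: "(real \<Rightarrow> complex) topology" where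
  "schwartz_topology =
     lc_topology schwartz_space {\<lambda>f. SUP x. \<bar>x\<bar> ^ j * cmod (nderiv k f x) | j k. True}"

definition fourier :: "(real \<Rightarrow> complex) \<Rightarrow> real \<Rightarrow> complex" where
  "fourier f x =
     of_real (1 / sqrt (2 * pi)) * (LINT y|lborel. exp (- \<i> * of_real (x * y)) * f y)"

definition Z_space :: "(real \<Rightarrow> complex) set" where
  "Z_space = {\<phi> \<in> schwartz_space. \<exists>g r. 0 < r \<and> g holomorphic_on UNIV \<and>
     (\<forall>x. g (of_real x) = \<phi> x) \<and>
     (\<forall>n::nat. \<exists>C. \<forall>z. cmod (g z) \<le> C * exp (r * \<bar>Im z\<bar>) / (1 + cmod z) ^ n)}"

text \<open>
  By the Paley--Wiener theorem the Fourier transform maps \<open>test_space UNIV\<close> bijectively onto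
  \<open>Z_space\<close>; the topology is the one carried over by this bijection.
\<close>

definition Z_topology :: "(real \<Rightarrow> complex) topology" where
  "Z_topology = lc_topology Z_space
     {p. seminorm_on Z_space p \<and> (\<lambda>f. p (fourier f)) \<in> test_seminorms UNIV}"

definition Zplus_space :: "(real \<Rightarrow> complex) set" where
  "Zplus_space = {F. (\<lambda>x. F (exp x)) \<in> Z_space \<and> (\<forall>t\<le>0. F t = 0)}"

definition Zplus_topology :: "(real \<Rightarrow> complex) topology" where
  "Zplus_topology = pullback_topology Zplus_space (\<lambda>F x. F (exp x)) Z_topology"

definition laplace_conv :: "(real \<Rightarrow> complex) \<Rightarrow> (real \<Rightarrow> complex) \<Rightarrow> real \<Rightarrow> complex" where
  "laplace_conv f g t = (LINT s:{0..t}|lborel. f s * g (t - s))"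

definition l2norm_pos :: "(real \<Rightarrow> complex) \<Rightarrow> real" where
  "l2norm_pos f = sqrt (LINT t:{0<..}|lborel. (cmod (f t))\<^sup>2)"

text \<open>
  The distribution \<open>\<theta>(x) = e\<^sup>x h(e\<^sup>x)\<close>, that is \<open>\<langle>\<theta>, \<Omega>\<rangle> = \<langle>h, F\<rangle>\<close> for \<open>F(t) = \<Omega>(ln t)\<close>.
\<close>

definition log_dist :: "((real \<Rightarrow> complex) \<Rightarrow> complex) \<Rightarrow> (real \<Rightarrow> complex) \<Rightarrow> complex" where
  "log_dist h \<Omega> = h (\<lambda>t. if 0 < t then \<Omega> (ln t) else 0)"

lemma topspace_lc_topology:
  assumes "P \<noteq> {}" "\<And>p. p \<in> P \<Longrightarrow> p (\<lambda>x. 0) = 0"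
  shows "topspace (lc_topology X P) = X"
proof -
  obtain p where p: "p \<in> P" using assms(1) by blast
  have p0: "p (\<lambda>x. 0) = 0" using assms(2)[OF p] .
  have "f \<in> \<Union> {{g \<in> X. p (\<lambda>x. g x - f x) < e} | p f e. p \<in> P \<and> f \<in> X \<and> 0 < e}"
    if "f \<in> X" for f
  proof
    show "f \<in> {g \<in> X. p (\<lambda>x. g x - f x) < 1}" using that by (simp add: p0)
    show "{g \<in> X. p (\<lambda>x. g x - f x) < 1} \<in>
      {{g \<in> X. p (\<lambda>x. g x - f x) < e} | p f e. p \<in> P \<and> f \<in> X \<and> 0 < e}"
      using that p zero_less_one by blast
  qed
  then show ?thesis unfolding lc_topology_def topology_generated_by_topspace by blast
qed

lemma seminorm_on_zero: "seminorm_on X p \<Longrightarrow> f \<in> X \<Longrightarrow> p (\<lambda>x. 0) = 0"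
  unfolding seminorm_on_def by (drule conjunct2, drule spec[of _ 0], drule bspec) simp_all

lemma nderiv_zero: "nderiv n (\<lambda>x. 0) = (\<lambda>x. 0)"
  by (induction n) (simp_all add: nderiv_def)

lemma smooth_zero: "smooth (\<lambda>x. 0)"
  by (simp add: smooth_def nderiv_zero)

lemma zero_in_test_space: "(\<lambda>x. 0) \<in> test_space U"
  by (simp add: test_space_def smooth_zero supp_def)

lemma zero_in_schwartz_space: "(\<lambda>x. 0) \<in> schwartz_space"
  by (simp add: schwartz_space_def smooth_zero nderiv_zero)

lemma zero_in_Z_space: "(\<lambda>x. 0) \<in> Z_space"
proof -
  have "\<exists>C. \<forall>z. cmod 0 \<le> C * exp (1 * \<bar>Im z\<bar>) / (1 + cmod z) ^ n" for n
    by (rule exI[of _ 0]) simp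
  then show ?thesis
    unfolding Z_space_def mem_Collect_eq
    by (intro conjI zero_in_schwartz_space exI[of _ "\<lambda>z. 0"] exI[of _ "1::real"] allI) simp_all
qed

lemma zero_in_test_seminorms: "(\<lambda>f. 0) \<in> test_seminorms U"
proof -
  have "\<exists>C N. \<forall>f\<in>test_space U. supp f \<subseteq> K \<longrightarrow>
      0 \<le> C * (\<Sum>n\<le>(N::nat). SUP x. cmod (nderiv n f x))" for K
    by (rule exI[of _ 0]) simp
  then show ?thesis by (simp add: test_seminorms_def seminorm_on_def)
qed

lemma topspace_test_topology [simp]: "topspace (test_topology U) = test_space U"
  unfolding test_topology_def
proof (rule topspace_lc_topology)
  show "test_seminorms U \<noteq> {}" using zero_in_test_seminorms by blast
qed (use seminorm_on_zero zero_in_test_space in \<open>auto simp: test_seminorms_def\<close>)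

lemma topspace_schwartz_topology [simp]: "topspace schwartz_topology = schwartz_space"
  unfolding schwartz_topology_def
  by (rule topspace_lc_topology) (auto simp: nderiv_zero)

lemma topspace_Z_topology [simp]: "topspace Z_topology = Z_space"
  unfolding Z_topology_def
proof (rule topspace_lc_topology)
  have "(\<lambda>f. 0) \<in> {p. seminorm_on Z_space p \<and> (\<lambda>f. p (fourier f)) \<in> test_seminorms UNIV}"
    using zero_in_test_seminorms by (simp add: seminorm_on_def)
  then show "{p. seminorm_on Z_space p \<and> (\<lambda>f. p (fourier f)) \<in> test_seminorms UNIV} \<noteq> {}"
    by blast
qed (use seminorm_on_zero zero_in_Z_space in auto)

lemma topspace_Zplus_topology [simp]: "topspace Zplus_topology = Zplus_space"
  by (auto simp: Zplus_topology_def topspace_pullback_topology Zplus_space_def)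

end

theory Submission
  imports Defs
begin

text \<open>
  The hypothesis is invariant under dilations of the argument, so it suffices to bound \<open>h F\<close> by
  \<open>sup |F| + a sup |F'|\<close> for \<open>F\<close> supported in \<open>[a, 4a]\<close>, with a constant independent of \<open>a\<close>, and to sum
  over a smooth dyadic partition of unity; the logarithmic weight makes the sum converge.

  By polarization, \<open>|h (f \<star> g)| \<le> const a sup |f| sup |g|\<close> for \<open>f\<close>, \<open>g\<close> supported in \<open>[a/2, 4a]\<close>. Let
  \<open>f(s) = F(s + a/2)\<close> and let \<open>\<chi>\<close> be a cutoff equal to \<open>1\<close> up to \<open>a\<close> and to \<open>0\<close> from \<open>2a\<close> on. Integration by
  parts gives \<open>F = \<chi>\<^sub>1 \<star> f' - \<chi>' \<star> f\<close>, where \<open>\<chi>\<^sub>1\<close> is the restriction of \<open>\<chi>\<close> to \<open>s > a/2\<close>. Smoothing the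
  jump of \<open>\<chi>\<^sub>1\<close> over a length \<open>\<delta> \<rightarrow> 0\<close> approximates \<open>F\<close> in the space of test functions by sums of two
  convolutions whose factors are uniformly bounded. Only one derivative of \<open>F\<close> enters.

  The functional is extended to Schwartz functions through the same partition of unity. For the
  continuity on \<open>Z_space\<close> no Paley--Wiener theorem is needed: \<open>|\<Theta>|\<close> is itself one of the generating
  seminorms, because partial integration bounds the Schwartz norms of a Fourier transform.
\<close>

section \<open>Smooth functions and a smooth step\<close>

text \<open>The scale invariance rests on one cancellation: squared L^2 norms on an interval of
  length comparable to \<open>a\<close> cost a factor \<open>a\<close>, and the single derivative in
  each of the two convolutions, on \<open>F\<close> or on the cutoff, gives it back as
  \<open>1/a\<close>. The obstacle is that \<open>h\<close> has an unknown order on each compact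
  set, so its continuity yields no uniform constant, while the quadratic bound speaks only of smooth
  factors supported away from 0 and excludes a factor with a jump. Each property therefore does what
  the other cannot: the quadratic bound estimates the convolutions uniformly in \<delta>, and
  continuity is invoked only to make the remainder vanish with \<delta>; its constants, which depend
  on \<open>F\<close> and \<open>a\<close>, disappear in the limit. The shift by \<open>a/2\<close>
  splits the support of \<open>F\<close>, which starts at \<open>a\<close>, between two factors that
  both stay away from 0. The power of the logarithm comes from counting scales: on the
  \<open>k\<close>-th dyadic interval \<open>1 + |ln t|\<close> is at least a quarter of
  \<open>1 + |k|\<close>, and the squares of the reciprocals are summable.\<close>

primrec diffn :: "nat \<Rightarrow> real set \<Rightarrow> (real \<Rightarrow> 'a::real_normed_vector) \<Rightarrow> bool" where
  "diffn 0 U f = True"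
| "diffn (Suc n) U f =
    (\<exists>f'. (\<forall>x\<in>U. (f has_vector_derivative f' x) (at x)) \<and> diffn n U f')"

lemma diffn_SucI:
  "(\<And>x. x \<in> U \<Longrightarrow> (f has_vector_derivative f' x) (at x)) \<Longrightarrow> diffn n U f' \<Longrightarrow> diffn (Suc n) U f"
  by auto

lemma diffn_SucE:
  assumes "diffn (Suc n) U f"
  obtains f' where "\<And>x. x \<in> U \<Longrightarrow> (f has_vector_derivative f' x) (at x)" "diffn n U f'"
  using assms by auto

lemma diffn_Suc_lower: "diffn (Suc n) U f \<Longrightarrow> diffn n U f"
proof (induction n arbitrary: f)
  case (Suc n)
  from Suc.prems obtain f' where f': "\<And>x. x \<in> U \<Longrightarrow> (f has_vector_derivative f' x) (at x)" "diffn (Suc n) U f'"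
    by (rule diffn_SucE) blast
  show ?case by (rule diffn_SucI[OF f'(1) Suc.IH[OF f'(2)]])
qed simp

lemma diffn_subset: "diffn n U f \<Longrightarrow> V \<subseteq> U \<Longrightarrow> diffn n V f"
proof (induction n arbitrary: f)
  case (Suc n)
  from Suc.prems(1) obtain f' where f': "\<And>x. x \<in> U \<Longrightarrow> (f has_vector_derivative f' x) (at x)" "diffn n U f'"
    by (rule diffn_SucE) blast
  show ?case by (rule diffn_SucI[of _ _ f']) (use f' Suc in auto)
qed simp

lemma diffn_cong:
  assumes "open U" "\<And>x. x \<in> U \<Longrightarrow> f x = g x" "diffn n U f"
  shows "diffn n U g"
proof (cases n)
  case (Suc m)
  with assms(3) obtain f' where f': "\<And>x. x \<in> U \<Longrightarrow> (f has_vector_derivative f' x) (at x)" "diffn m U f'"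
    by (auto elim: diffn_SucE)
  show ?thesis unfolding Suc
    by (rule diffn_SucI[OF _ f'(2)])
      (use f'(1) assms(1,2) in \<open>auto intro: has_vector_derivative_transform_within_open\<close>)
qed simp

lemma diffn_Suc_iff:
  assumes "open U"
  shows "diffn (Suc n) U f \<longleftrightarrow>
    (\<forall>x\<in>U. f differentiable (at x)) \<and> diffn n U (\<lambda>x. vector_derivative f (at x))"
proof
  assume "diffn (Suc n) U f"
  then obtain f' where f': "\<And>x. x \<in> U \<Longrightarrow> (f has_vector_derivative f' x) (at x)" "diffn n U f'"
    by (rule diffn_SucE) blast
  have "diffn n U (\<lambda>x. vector_derivative f (at x))"
    by (rule diffn_cong[OF assms _ f'(2)]) (rule vector_derivative_at[OF f'(1), symmetric])
  then show "(\<forall>x\<in>U. f differentiable (at x)) \<and> diffn n U (\<lambda>x. vector_derivative f (at x))"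
    using f'(1) differentiableI_vector by blast
next
  assume "(\<forall>x\<in>U. f differentiable (at x)) \<and> diffn n U (\<lambda>x. vector_derivative f (at x))"
  then show "diffn (Suc n) U f"
    by (intro diffn_SucI[of _ _ "\<lambda>x. vector_derivative f (at x)"])
      (auto simp: vector_derivative_works)
qed

text \<open>The existential derivatives on \<open>U\<close> and on \<open>V\<close> may be different
  functions; \<open>diffn_Suc_iff\<close> replaces both by \<open>vector_derivative\<close>. The
  lemma serves to glue functions on the half-line to their extension by zero.\<close>

lemma diffn_Un:
  "open U \<Longrightarrow> open V \<Longrightarrow> diffn n U f \<Longrightarrow> diffn n V f \<Longrightarrow> diffn n (U \<union> V) f"
proof (induction n arbitrary: f)
  case (Suc n)
  then show ?case
    by (simp add: diffn_Suc_iff open_Un ball_Un del: diffn.simps(2))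
qed simp

lemma diffn_const: "diffn n U (\<lambda>x. c)"
  by (induction n arbitrary: c) (auto intro!: diffn_SucI[of _ _ "\<lambda>x. 0"] derivative_eq_intros simp del: diffn.simps(2))

lemma diffn_ident: "diffn n U (\<lambda>x::real. x)"
  by (cases n) (auto intro!: diffn_SucI[of _ _ "\<lambda>x. 1"] diffn_const simp del: diffn.simps(2))

lemma diffn_add: "diffn n U f \<Longrightarrow> diffn n U g \<Longrightarrow> diffn n U (\<lambda>x. f x + g x)"
proof (induction n arbitrary: f g)
  case (Suc n)
  from Suc.prems(1) obtain f' where f': "\<And>x. x \<in> U \<Longrightarrow> (f has_vector_derivative f' x) (at x)" "diffn n U f'"
    by (rule diffn_SucE) blast
  from Suc.prems(2) obtain g' where g': "\<And>x. x \<in> U \<Longrightarrow> (g has_vector_derivative g' x) (at x)" "diffn n U g'"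
    by (rule diffn_SucE) blast
  show ?case
    by (rule diffn_SucI[OF _ Suc.IH[OF f'(2) g'(2)]]) (intro has_vector_derivative_add f' g')
qed simp

lemma diffn_bounded_linear:
  assumes "bounded_linear L" shows "diffn n U f \<Longrightarrow> diffn n U (\<lambda>x. L (f x))"
proof (induction n arbitrary: f)
  case (Suc n)
  from Suc.prems(1) obtain f' where f': "\<And>x. x \<in> U \<Longrightarrow> (f has_vector_derivative f' x) (at x)" "diffn n U f'"
    by (rule diffn_SucE) blast
  show ?case
    by (rule diffn_SucI[OF _ Suc.IH[OF f'(2)]])
     (intro bounded_linear.has_vector_derivative[OF assms] f')
qed simp

lemma diffn_bilinear:
  assumes "bounded_bilinear B"
  shows "diffn n U f \<Longrightarrow> diffn n U g \<Longrightarrow> diffn n U (\<lambda>x. B (f x) (g x))"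
proof (induction n arbitrary: f g)
  case (Suc n)
  from Suc.prems(1) obtain f' where f': "\<And>x. x \<in> U \<Longrightarrow> (f has_vector_derivative f' x) (at x)" "diffn n U f'"
    by (rule diffn_SucE) blast
  from Suc.prems(2) obtain g' where g': "\<And>x. x \<in> U \<Longrightarrow> (g has_vector_derivative g' x) (at x)" "diffn n U g'"
    by (rule diffn_SucE) blast
  have "diffn n U (\<lambda>x. B (f x) (g' x) + B (f' x) (g x))"
    by (intro diffn_add Suc.IH[OF diffn_Suc_lower[OF Suc.prems(1)] g'(2)]
        Suc.IH[OF f'(2) diffn_Suc_lower[OF Suc.prems(2)]])
  then show ?case
    by (rule diffn_SucI[rotated])
      (intro bounded_bilinear.has_vector_derivative[OF assms] f' g')
qed simp

lemmas diffn_mult = diffn_bilinear[OF bounded_bilinear_mult]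
lemmas diffn_scaleR = diffn_bilinear[OF bounded_bilinear_scaleR]
lemmas diffn_of_real = diffn_bounded_linear[OF bounded_linear_of_real]
lemmas diffn_cnj = diffn_bounded_linear[OF bounded_linear_cnj]

lemma diffn_diff:
  fixes f g :: "real \<Rightarrow> 'a::real_normed_vector"
  shows "diffn n U f \<Longrightarrow> diffn n U g \<Longrightarrow> diffn n U (\<lambda>x. f x - g x)"
  using diffn_add[of n U f "\<lambda>x. - g x"] diffn_bounded_linear[OF bounded_linear_minus[OF bounded_linear_ident], of n U g]
  by simp

text \<open>The existential form of \<open>diffn\<close> pays off here: one chain rule per induction
  step is enough, and no formula for higher derivatives of a composite appears.\<close>

lemma diffn_compose:
  assumes "\<And>x. x \<in> U \<Longrightarrow> \<phi> x \<in> V"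
  shows "diffn n V f \<Longrightarrow> diffn n U \<phi> \<Longrightarrow> diffn n U (\<lambda>x. f (\<phi> x))"
proof (induction n arbitrary: f)
  case (Suc n)
  from Suc.prems(1) obtain f' where f': "\<And>x. x \<in> V \<Longrightarrow> (f has_vector_derivative f' x) (at x)" "diffn n V f'"
    by (rule diffn_SucE) blast
  from Suc.prems(2) obtain p' where p': "\<And>x. x \<in> U \<Longrightarrow> (\<phi> has_vector_derivative p' x) (at x)" "diffn n U p'"
    by (rule diffn_SucE) blast
  have "diffn n U (\<lambda>x. p' x *\<^sub>R f' (\<phi> x))"
    by (rule diffn_scaleR[OF p'(2) Suc.IH[OF f'(2) diffn_Suc_lower[OF Suc.prems(2)]]])
  then show ?case
    by (rule diffn_SucI[rotated])
     (use vector_diff_chain_at[OF p'(1) f'(1)[OF assms]] in \<open>simp add: o_def\<close>)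
qed simp

lemma diffn_inverse: "0 \<notin> U \<Longrightarrow> diffn n U (\<lambda>x::real. 1 / x)"
proof (induction n)
  case (Suc n)
  have "diffn n U (\<lambda>x. (-1) * ((1 / x) * (1 / x)))"
    by (intro diffn_mult diffn_const Suc)
  then show ?case
    apply (rule diffn_SucI[rotated])
    using Suc.prems unfolding has_real_derivative_iff_has_vector_derivative[symmetric]
    by (auto intro!: derivative_eq_intros simp: power2_eq_square)
qed simp

lemma diffn_ln: "diffn n {0<..} (ln :: real \<Rightarrow> real)"
proof (cases n)
  case (Suc m)
  show ?thesis unfolding Suc
    by (rule diffn_SucI[of _ _ "\<lambda>x. 1 / x"])
      (auto intro!: diffn_inverse derivative_eq_intros simp: has_real_derivative_iff_has_vector_derivative[symmetric])
qed simp

lemma nderiv_0 [simp]: "nderiv 0 f = f"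
  by (simp add: nderiv_def)

lemma nderiv_Suc: "nderiv (Suc n) f x = vector_derivative (nderiv n f) (at x)"
  by (simp add: nderiv_def)

lemma nderiv_Suc_inner: "nderiv (Suc n) f = nderiv n (\<lambda>x. vector_derivative f (at x))"
  unfolding nderiv_def funpow_Suc_right o_apply ..

text \<open>Division of labour: closure properties and gluing are proved for \<open>diffn\<close>,
  explicit derivatives are computed with \<open>nderiv\<close>.\<close>

lemma smooth_iff_diffn: "smooth f \<longleftrightarrow> (\<forall>n. diffn n UNIV f)"
proof
  have "(\<forall>n x. nderiv n f differentiable (at x)) \<Longrightarrow> diffn n UNIV f" for n f
  proof (induction n arbitrary: f)
    case (Suc n)
    have "\<forall>k x. nderiv k (\<lambda>x. vector_derivative f (at x)) differentiable (at x)"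
      using Suc.prems by (metis nderiv_Suc_inner)
    moreover have "f differentiable (at x)" for x
      using Suc.prems[rule_format, of 0 x] by simp
    ultimately show ?case
      using Suc.IH by (simp add: diffn_Suc_iff del: diffn.simps(2))
  qed simp
  then show "smooth f \<Longrightarrow> \<forall>n. diffn n UNIV f" by (simp add: smooth_def)
  have "\<forall>k. diffn k UNIV f \<Longrightarrow> nderiv n f differentiable (at x)" for n f x
  proof (induction n arbitrary: f)
    case 0
    from 0[rule_format, of "Suc 0"] show ?case by (simp add: diffn_Suc_iff del: diffn.simps(2))
  next
    case (Suc n)
    have "diffn k UNIV (\<lambda>x. vector_derivative f (at x))" for k
      using Suc.prems[rule_format, of "Suc k"] by (simp add: diffn_Suc_iff del: diffn.simps(2))
    then show ?case unfolding nderiv_Suc_inner by (intro Suc.IH) blast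
  qed
  then show "\<forall>n. diffn n UNIV f \<Longrightarrow> smooth f" by (simp add: smooth_def)
qed

lemma smooth_nderiv_deriv: "smooth f \<Longrightarrow> (nderiv n f has_vector_derivative nderiv (Suc n) f x) (at x)"
  unfolding smooth_def nderiv_Suc vector_derivative_works[symmetric] by blast

text \<open>The recurring way to compute \<open>nderiv\<close>: exhibit a family whose members
  differentiate into the next one. The same family gives smoothness through
  \<open>smooth_derivs\<close>.\<close>

lemma nderiv_unique:
  assumes "g 0 = f" and g: "\<And>n x. (g n has_vector_derivative g (Suc n) x) (at x)"
  shows "nderiv n f = g n"
proof (induction n)
  case (Suc n)
  show ?case
    by (rule ext) (use Suc vector_derivative_at[OF g] in \<open>simp add: nderiv_Suc\<close>)
qed (use assms in simp)

lemma smooth_derivs: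
  assumes "g 0 = f" and g: "\<And>n x. (g n has_vector_derivative g (Suc n) x) (at x)"
  shows "smooth f"
  unfolding smooth_def nderiv_unique[OF assms] using g differentiableI_vector by blast

lemma smooth_nderiv: "smooth f \<Longrightarrow> smooth (nderiv k f)"
  by (rule smooth_derivs[of "\<lambda>n. nderiv (n + k) f"]) (auto intro: smooth_nderiv_deriv)

lemma nderiv_nderiv: "smooth f \<Longrightarrow> nderiv n (nderiv k f) = nderiv (n + k) f"
  by (rule nderiv_unique[of "\<lambda>n. nderiv (n + k) f"]) (auto intro: smooth_nderiv_deriv)

lemma continuous_nderiv: "smooth f \<Longrightarrow> continuous_on A (nderiv n f)"
  by (meson continuous_at_imp_continuous_on has_vector_derivative_continuous smooth_nderiv_deriv)

lemma smooth_continuous: "smooth f \<Longrightarrow> continuous_on A f"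
  using continuous_nderiv[of f A 0] by simp

lemma smooth_add: "smooth f \<Longrightarrow> smooth g \<Longrightarrow> smooth (\<lambda>x. f x + g x)"
  by (simp add: smooth_iff_diffn diffn_add)

lemma smooth_diff: "smooth f \<Longrightarrow> smooth g \<Longrightarrow> smooth (\<lambda>x. f x - g x)"
  by (simp add: smooth_iff_diffn diffn_diff)

lemma smooth_mult: "smooth f \<Longrightarrow> smooth g \<Longrightarrow> smooth (\<lambda>x. f x * g x)"
  by (simp add: smooth_iff_diffn diffn_mult)

lemma smooth_const: "smooth (\<lambda>x. c)"
  by (simp add: smooth_iff_diffn diffn_const)

lemma smooth_cnj: "smooth f \<Longrightarrow> smooth (\<lambda>x. cnj (f x))"
  by (simp add: smooth_iff_diffn diffn_cnj)

lemma nderiv_add: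
  "smooth f \<Longrightarrow> smooth g \<Longrightarrow> nderiv n (\<lambda>x. f x + g x) = (\<lambda>x. nderiv n f x + nderiv n g x)"
  by (rule nderiv_unique[of "\<lambda>n x. nderiv n f x + nderiv n g x"])
    (auto intro!: derivative_intros smooth_nderiv_deriv)

lemma nderiv_diff:
  "smooth f \<Longrightarrow> smooth g \<Longrightarrow> nderiv n (\<lambda>x. f x - g x) = (\<lambda>x. nderiv n f x - nderiv n g x)"
  by (rule nderiv_unique[of "\<lambda>n x. nderiv n f x - nderiv n g x"])
    (auto intro!: derivative_intros smooth_nderiv_deriv)

lemma nderiv_cmult: "smooth f \<Longrightarrow> nderiv n (\<lambda>x. c * f x) = (\<lambda>x. c * nderiv n f x)"
  by (rule nderiv_unique[of "\<lambda>n x. c * nderiv n f x"])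
    (auto intro!: bounded_linear.has_vector_derivative[OF bounded_linear_mult_right] smooth_nderiv_deriv)

lemma shift_deriv:
  "smooth f \<Longrightarrow> ((\<lambda>x. nderiv n f (x + c)) has_vector_derivative nderiv (Suc n) f (x + c)) (at x)"
  using vector_diff_chain_at[of "\<lambda>x. x + c" 1 x "nderiv n f" "nderiv (Suc n) f (x + c)"]
    smooth_nderiv_deriv[of f n "x + c"] has_vector_derivative_add_const[of "\<lambda>x. x" c 1 "at x"]
  by (simp add: o_def)

lemma smooth_shift: "smooth f \<Longrightarrow> smooth (\<lambda>x. f (x + c))"
  by (rule smooth_derivs[of "\<lambda>n x. nderiv n f (x + c)"]) (auto intro: shift_deriv)

lemma nderiv_shift: "smooth f \<Longrightarrow> nderiv n (\<lambda>x. f (x + c)) = (\<lambda>x. nderiv n f (x + c))"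
  by (rule nderiv_unique[of "\<lambda>n x. nderiv n f (x + c)"]) (auto intro: shift_deriv)

section \<open>Smooth cutoffs built from exp(-1/t)\<close>

definition flat_exp :: "nat \<Rightarrow> real \<Rightarrow> real" where
  "flat_exp n t = (if t \<le> 0 then 0 else (1 / t) ^ n * exp (- (1 / t)))"

lemma flat_exp_tendsto: "(flat_exp n \<longlongrightarrow> 0) (at_right 0)"
proof -
  have "((\<lambda>t. inverse t ^ n / exp (inverse t)) \<longlongrightarrow> 0) (at_right (0::real))"
    by (rule filterlim_compose[OF tendsto_power_div_exp_0 filterlim_inverse_at_top_right])
  then show ?thesis
    by (rule Lim_transform_eventually)
      (auto simp: flat_exp_def exp_minus divide_inverse eventually_at_filter)
qed

text \<open>The index \<open>n\<close> makes the family closed under differentiation: the derivative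
  of \<open>t^(-n) exp(-1/t)\<close> is the same exponential times
  \<open>t^(-n-2) - n t^(-n-1)\<close>. Smoothness then follows by induction over all
  \<open>n\<close> at once.\<close>

lemma flat_exp_deriv:
  "(flat_exp n has_real_derivative flat_exp (n + 2) t - real n * flat_exp (n + 1) t) (at t)"
proof -
  consider "t < 0" | "t = 0" | "t > 0" by linarith
  then show ?thesis
  proof cases
    case 1
    have "((\<lambda>t. 0) has_real_derivative 0) (at t)" by simp
    then have "(flat_exp n has_real_derivative 0) (at t)"
      by (rule has_field_derivative_transform_within_open[where S = "{..<0}"])
        (use 1 in \<open>auto simp: flat_exp_def\<close>)
    then show ?thesis using 1 by (simp add: flat_exp_def)
  next
    case 2
    \<comment> \<open>To the right of 0 the difference quotient of \<open>flat_exp n\<close> at 0 is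
      \<open>flat_exp (Suc n)\<close>, which tends to 0.\<close>
    have "((\<lambda>t. (flat_exp n t - flat_exp n 0) / (t - 0)) \<longlongrightarrow> 0) (at_right 0)"
      by (rule Lim_transform_eventually[OF flat_exp_tendsto[of "Suc n"]])
        (auto simp: flat_exp_def eventually_at_filter)
    moreover have "((\<lambda>t. (flat_exp n t - flat_exp n 0) / (t - 0)) \<longlongrightarrow> 0) (at_left 0)"
      by (rule Lim_transform_eventually[OF tendsto_const])
        (auto simp: flat_exp_def eventually_at_filter)
    ultimately have "((\<lambda>t. (flat_exp n t - flat_exp n 0) / (t - 0)) \<longlongrightarrow> 0) (at 0)"
      using filterlim_split_at by blast
    then show ?thesis using 2 by (simp add: has_field_derivative_iff flat_exp_def)
  next
    case 3
    have "((\<lambda>t. (1 / t) ^ n * exp (- (1 / t))) has_real_derivative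
        flat_exp (n + 2) t - real n * flat_exp (n + 1) t) (at t)"
      using 3 by (cases n; cases "n - 1")
        (auto intro!: derivative_eq_intros simp: flat_exp_def field_simps power2_eq_square,
          metis One_nat_def power_eq_if)
    then show ?thesis
      by (rule has_field_derivative_transform_within_open[where S = "{0<..}"])
        (use 3 in \<open>auto simp: flat_exp_def\<close>)
  qed
qed

lemma diffn_flat_exp: "diffn k U (flat_exp n)"
proof (induction k arbitrary: n)
  case (Suc k)
  show ?case
    by (rule diffn_SucI[of _ _ "\<lambda>t. flat_exp (n + 2) t - real n * flat_exp (n + 1) t"])
     (intro flat_exp_deriv[unfolded has_real_derivative_iff_has_vector_derivative] diffn_diff diffn_mult diffn_const Suc)+
qed simp

text \<open>The denominator never vanishes because \<open>t\<close> and \<open>1 - t\<close> cannot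
  both be nonpositive. The quotient is written as a product with a reciprocal so that
  \<open>diffn_mult\<close> and \<open>diffn_inverse\<close> apply.\<close>

definition step :: "real \<Rightarrow> real" where
  "step t = flat_exp 0 t * (1 / (flat_exp 0 t + flat_exp 0 (1 - t)))"

lemma flat_exp_nonneg: "flat_exp n t \<ge> 0"
  by (simp add: flat_exp_def)

lemma step_denominator: "flat_exp 0 t + flat_exp 0 (1 - t) > 0"
  by (auto simp: flat_exp_def add_pos_pos)

lemma step_bounds: "0 \<le> step t" "step t \<le> 1"
  using step_denominator[of t] flat_exp_nonneg[of 0] by (auto simp: step_def field_simps)

lemma step_0: "t \<le> 0 \<Longrightarrow> step t = 0"
  by (simp add: step_def flat_exp_def)

lemma step_1: "t \<ge> 1 \<Longrightarrow> step t = 1"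
  using step_denominator[of t] by (simp add: step_def) (simp add: flat_exp_def)

lemma diffn_step: "diffn n UNIV step"
proof -
  have c: "diffn n UNIV (\<lambda>t. flat_exp 0 (1 - t))"
    by (rule diffn_compose[of _ _ UNIV]) (auto intro: diffn_diff diffn_const diffn_ident diffn_flat_exp)
  have "diffn n UNIV (\<lambda>t. 1 / (flat_exp 0 t + flat_exp 0 (1 - t)))"
    by (rule diffn_compose[where V = "{0<..}" and \<phi> = "\<lambda>t. flat_exp 0 t + flat_exp 0 (1 - t)"])
     (auto intro!: diffn_inverse diffn_add diffn_flat_exp c step_denominator)
  then show ?thesis
    unfolding step_def[abs_def] by (intro diffn_mult diffn_flat_exp)
qed

definition dstep :: "real \<Rightarrow> real \<Rightarrow> real \<Rightarrow> complex" where
  "dstep a b t = of_real (step ((t - a) / b))"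

lemma smooth_dstep: "smooth (dstep a b)"
proof -
  have "diffn n UNIV (\<lambda>t. (t - a) / b)" for n
    unfolding divide_inverse by (intro diffn_mult diffn_diff diffn_ident diffn_const)
  then have "diffn n UNIV (\<lambda>t. step ((t - a) / b))" for n
    by (rule diffn_compose[where V = UNIV and f = step, OF UNIV_I diffn_step])
  then show ?thesis
    unfolding smooth_iff_diffn dstep_def[abs_def] by (intro allI diffn_of_real)
qed

lemma dstep_0: "b > 0 \<Longrightarrow> t \<le> a \<Longrightarrow> dstep a b t = 0"
  by (simp add: dstep_def step_0 divide_nonpos_pos)

lemma dstep_1: "b > 0 \<Longrightarrow> t \<ge> a + b \<Longrightarrow> dstep a b t = 1"
  by (simp add: dstep_def step_1 field_simps)

lemma norm_dstep: "cmod (dstep a b t) \<le> 1" "cmod (1 - dstep a b t) \<le> 1"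
proof -
  show "cmod (dstep a b t) \<le> 1" using step_bounds by (simp add: dstep_def)
  have "1 - dstep a b t = of_real (1 - step ((t - a) / b))" by (simp add: dstep_def)
  then show "cmod (1 - dstep a b t) \<le> 1"
    using step_bounds[of "(t - a) / b"] by (simp only: norm_of_real)
qed

text \<open>All these cutoffs are affine rescalings of one \<open>step\<close>, whose derivative
  vanishes off the unit interval and is bounded on it; the chain rule contributes
  \<open>1 / b\<close>. One \<open>D\<close> for all \<open>a\<close> and \<open>b\<close> is what
  makes the later estimates independent of the scale.\<close>

lemma dstep_deriv_bound:
  obtains D where "D > 0" "\<And>a b t. b > 0 \<Longrightarrow> cmod (nderiv 1 (dstep a b) t) \<le> D / b"
proof -
  \<comment> \<open>The second derivative is asked for only to know that \<open>s'\<close> is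
    continuous, hence bounded on the unit interval.\<close>
  have "diffn (Suc (Suc 0)) UNIV step" by (rule diffn_step)
  then obtain s' s'' where s': "\<And>x. (step has_vector_derivative s' x) (at x)"
    and s'': "\<And>x. (s' has_vector_derivative s'' x) (at x)"
    by auto
  have "continuous_on {0..1} s'"
    by (meson continuous_at_imp_continuous_on has_vector_derivative_continuous s'')
  then have "bounded (s' ` {0..1})" by (intro compact_imp_bounded compact_continuous_image) auto
  then obtain D where D: "D > 0" "\<And>x. x \<in> {0..1} \<Longrightarrow> \<bar>s' x\<bar> \<le> D"
    unfolding bounded_pos by auto
  have z1: "s' x = 0" if "x < 0" for x
  proof -
    have "(step has_vector_derivative 0) (at x)"
      by (rule has_vector_derivative_transform_within_open[where f = "\<lambda>x. 0" and S = "{..<0}"])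
        (use that in \<open>auto simp: step_0\<close>)
    then show ?thesis using s' vector_derivative_unique_at by blast
  qed
  have z2: "s' x = 0" if "x > 1" for x
  proof -
    have "(step has_vector_derivative 0) (at x)"
      by (rule has_vector_derivative_transform_within_open[where f = "\<lambda>x. 1" and S = "{1<..}"])
        (use that in \<open>auto simp: step_1\<close>)
    then show ?thesis using s' vector_derivative_unique_at by blast
  qed
  have sb: "\<bar>s' x\<bar> \<le> D" for x
    using D z1[of x] z2[of x] by (cases "x < 0"; cases "x > 1") auto
  have "cmod (nderiv 1 (dstep a b) t) \<le> D / b" if "b > 0" for a b t
  proof -
    have 1: "((\<lambda>t. (t - a) / b) has_vector_derivative (1 / b)) (at t)"
      using that by (auto simp: has_real_derivative_iff_has_vector_derivative[symmetric] intro!: derivative_eq_intros)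
    have "(dstep a b has_vector_derivative of_real ((1 / b) * s' ((t - a) / b))) (at t)"
      unfolding dstep_def[abs_def]
      using bounded_linear.has_vector_derivative[OF bounded_linear_of_real vector_diff_chain_at[OF 1 s']]
      by (simp add: o_def del: of_real_divide)
    then have "nderiv 1 (dstep a b) t = of_real ((1 / b) * s' ((t - a) / b))"
      by (simp add: nderiv_Suc vector_derivative_at)
    then have "cmod (nderiv 1 (dstep a b) t) = \<bar>(1 / b) * s' ((t - a) / b)\<bar>"
      by (simp only: norm_of_real)
    then show ?thesis using sb[of "(t - a) / b"] that by (simp add: abs_mult divide_right_mono)
  qed
  then show ?thesis using that D(1) by blast
qed

section \<open>Test functions and continuous functionals\<close>

lemma supp_zero: "x \<notin> supp f \<Longrightarrow> f x = 0"
  using closure_subset[of "{x. f x \<noteq> 0}"] unfolding supp_def by blast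

lemma closed_supp: "closed (supp f)"
  by (simp add: supp_def)

lemma supp_subset: "closed K \<Longrightarrow> (\<And>x. x \<notin> K \<Longrightarrow> f x = 0) \<Longrightarrow> supp f \<subseteq> K"
  unfolding supp_def by (rule closure_minimal) auto

lemma test_spaceI:
  assumes "smooth f" "\<And>x. x \<notin> {\<alpha>..\<beta>} \<Longrightarrow> f x = 0" "{\<alpha>..\<beta>} \<subseteq> U"
  shows "f \<in> test_space U"
proof -
  have "supp f \<subseteq> {\<alpha>..\<beta>}" by (rule supp_subset) (use assms in auto)
  moreover have "closed (supp f)" by (simp add: supp_def)
  ultimately have "compact (supp f)"
    by (metis compact_Icc compact_Int_closed inf.absorb_iff2)
  then show ?thesis using assms \<open>supp f \<subseteq> _\<close> by (auto simp: test_space_def)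
qed

lemma test_space_smooth: "f \<in> test_space U \<Longrightarrow> smooth f"
  by (simp add: test_space_def)

lemma test_space_pos_bounds:
  assumes "f \<in> test_space {0<..}"
  obtains \<alpha> \<beta> where "0 < \<alpha>" "\<alpha> \<le> \<beta>" "\<And>x. x \<notin> {\<alpha>..\<beta>} \<Longrightarrow> f x = 0"
proof (cases "supp f = {}")
  case True
  then show ?thesis using that[of 1 1] supp_zero[of _ f] by auto
next
  case False
  have c: "compact (supp f)" "supp f \<subseteq> {0<..}" using assms by (auto simp: test_space_def)
  obtain \<alpha> where a: "\<alpha> \<in> supp f" "\<forall>t\<in>supp f. \<alpha> \<le> t" using compact_attains_inf[OF c(1) False] by blast
  obtain \<beta> where b: "\<beta> \<in> supp f" "\<forall>t\<in>supp f. t \<le> \<beta>" using compact_attains_sup[OF c(1) False] by blast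
  show ?thesis
  proof (rule that)
    show "0 < \<alpha>" using a c by auto
    show "\<alpha> \<le> \<beta>" using a b by auto
    show "f x = 0" if "x \<notin> {\<alpha>..\<beta>}" for x
      by (rule supp_zero) (use that a b in auto)
  qed
qed

lemma test_space_UNIV_bounds:
  assumes "f \<in> test_space UNIV"
  obtains R where "0 < R" "\<And>x. x \<notin> {-R..R} \<Longrightarrow> f x = 0"
proof -
  have "bounded (supp f)" using assms by (auto simp: test_space_def intro: compact_imp_bounded)
  then obtain R where R: "0 < R" "\<And>x. x \<in> supp f \<Longrightarrow> \<bar>x\<bar> \<le> R" unfolding bounded_pos by auto
  show ?thesis
  proof (rule that[OF R(1)])
    show "f x = 0" if "x \<notin> {-R..R}" for x
      by (rule supp_zero) (use that R(2)[of x] in auto)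
  qed
qed

lemma nderiv_zero_outside:
  assumes "\<And>x. x \<notin> {\<alpha>..\<beta>::real} \<Longrightarrow> f x = 0" "x \<notin> {\<alpha>..\<beta>}"
  shows "nderiv n f x = 0"
  using assms(2)
proof (induction n arbitrary: x)
  case (Suc n)
  have "(nderiv n f has_vector_derivative 0) (at x)"
    by (rule has_vector_derivative_transform_within_open[where f = "\<lambda>x. 0" and S = "-{\<alpha>..\<beta>}"])
      (use Suc in auto)
  then show ?case by (simp add: nderiv_Suc vector_derivative_at)
qed (use assms in auto)

lemma test_space_add:
  assumes "f \<in> test_space U" "g \<in> test_space U"
  shows "(\<lambda>x. f x + g x) \<in> test_space U"
proof -
  have s: "supp (\<lambda>x. f x + g x) \<subseteq> supp f \<union> supp g"
    by (rule supp_subset) (auto simp: supp_zero intro: closed_supp)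
  have "compact (supp f \<union> supp g)" using assms by (auto simp: test_space_def)
  then have "compact (supp (\<lambda>x. f x + g x))"
    using s compact_Int_closed[of "supp f \<union> supp g" "supp (\<lambda>x. f x + g x)"]
    by (simp add: inf.absorb2 closed_supp)
  then show ?thesis using assms s by (auto simp: test_space_def intro: smooth_add)
qed

lemma test_space_mult:
  assumes "f \<in> test_space U" "smooth g"
  shows "(\<lambda>x. g x * f x) \<in> test_space U"
proof -
  have s: "supp (\<lambda>x. g x * f x) \<subseteq> supp f"
    by (rule supp_subset) (auto simp: supp_zero intro: closed_supp)
  have "compact (supp f)" using assms by (auto simp: test_space_def)
  then have "compact (supp (\<lambda>x. g x * f x))"
    using s compact_Int_closed[of "supp f" "supp (\<lambda>x. g x * f x)"]
    by (simp add: inf.absorb2 closed_supp)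
  then show ?thesis using assms s by (auto simp: test_space_def intro: smooth_mult)
qed

lemma test_space_cmult: "f \<in> test_space U \<Longrightarrow> (\<lambda>x. c * f x) \<in> test_space U"
  by (rule test_space_mult[OF _ smooth_const])

lemma test_space_diff: "f \<in> test_space U \<Longrightarrow> g \<in> test_space U \<Longrightarrow> (\<lambda>x. f x - g x) \<in> test_space U"
  using test_space_add[of f U "\<lambda>x. - 1 * g x"] test_space_cmult[of g U "-1"] by simp

lemma test_space_sum:
  "(\<And>i. i \<in> I \<Longrightarrow> f i \<in> test_space U) \<Longrightarrow> (\<lambda>x. \<Sum>i\<in>I. f i x) \<in> test_space U"
  by (induction I rule: infinite_finite_induct) (auto intro: zero_in_test_space test_space_add)

lemma bdd_above_nderiv:
  assumes "f \<in> test_space U" shows "bdd_above (range (\<lambda>x. cmod (nderiv n f x)))"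
proof -
  have "f \<in> test_space UNIV" using assms by (auto simp: test_space_def)
  then obtain R where R: "0 < R" "\<And>x. x \<notin> {-R..R} \<Longrightarrow> f x = 0" by (rule test_space_UNIV_bounds) blast
  have "compact (nderiv n f ` {-R..R})"
    by (intro compact_continuous_image continuous_nderiv test_space_smooth[OF assms]) auto
  then obtain B where B: "B > 0" "\<And>x. x \<in> {-R..R} \<Longrightarrow> cmod (nderiv n f x) \<le> B"
    using compact_imp_bounded[of "nderiv n f ` {-R..R}"] unfolding bounded_pos by auto
  have "cmod (nderiv n f x) \<le> B" for x
    using B nderiv_zero_outside[of "-R" R f x n] R(2) by (cases "x \<in> {-R..R}") auto
  then show ?thesis by (intro bdd_aboveI[of _ B]) auto
qed

lemma norm_nderiv_le_SUP:
  "f \<in> test_space U \<Longrightarrow> cmod (nderiv n f x) \<le> (SUP x. cmod (nderiv n f x))"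
  by (rule cSUP_upper[OF UNIV_I bdd_above_nderiv])

section \<open>Continuity with respect to a generating family of seminorms\<close>

lemma antidual_iff:
  "h \<in> antidual T \<longleftrightarrow>
     (\<forall>f\<in>topspace T. \<forall>g\<in>topspace T. h (\<lambda>x. f x + g x) = h f + h g) \<and>
     (\<forall>c. \<forall>f\<in>topspace T. h (\<lambda>x. c * f x) = cnj c * h f) \<and>
     continuous_map T euclidean h"
  by (simp add: antidual_def)

lemma seminorm_on_add:
  "seminorm_on X p \<Longrightarrow> f \<in> X \<Longrightarrow> g \<in> X \<Longrightarrow> p (\<lambda>x. f x + g x) \<le> p f + p g"
  by (simp add: seminorm_on_def)

lemma seminorm_on_cmult: "seminorm_on X p \<Longrightarrow> f \<in> X \<Longrightarrow> p (\<lambda>x. c * f x) = cmod c * p f"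
  by (simp add: seminorm_on_def)

text \<open>The generating sets are balls around arbitrary centres \<open>f0\<close>. By the
  triangle inequality such a ball contains the ball of radius \<open>e0 - p (f - f0)\<close> around
  any of its points \<open>f\<close>, so neighbourhoods of \<open>f\<close> can be described by
  balls centred at \<open>f\<close>.\<close>

lemma lc_topology_nhd:
  assumes "openin (lc_topology X P) V" "f \<in> V"
    and P: "\<And>p. p \<in> P \<Longrightarrow> seminorm_on X p"
    and X: "\<And>f g. f \<in> X \<Longrightarrow> g \<in> X \<Longrightarrow> (\<lambda>x. f x - g x) \<in> X"
  obtains Q e where "finite Q" "Q \<subseteq> P" "e > 0" "\<And>g. g \<in> X \<Longrightarrow> (\<And>p. p \<in> Q \<Longrightarrow> p (\<lambda>x. g x - f x) < e) \<Longrightarrow> g \<in> V"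
proof -
  let ?S = "{{g \<in> X. p (\<lambda>x. g x - f x) < e} | p f e. p \<in> P \<and> f \<in> X \<and> 0 < e}"
  have "generate_topology_on ?S V"
    using assms(1) unfolding lc_topology_def openin_topology_generated_by_iff .
  then have "\<forall>f\<in>V. \<exists>Q e. finite Q \<and> Q \<subseteq> P \<and> e > 0 \<and> (\<forall>g\<in>X. (\<forall>p\<in>Q. p (\<lambda>x. g x - f x) < e) \<longrightarrow> g \<in> V)"
  proof induction
    case (Int a b)
    show ?case
    proof
      fix f assume f: "f \<in> a \<inter> b"
      obtain Q1 e1 where 1: "finite Q1" "Q1 \<subseteq> P" "(e1::real) > 0" "\<forall>g\<in>X. (\<forall>p\<in>Q1. p (\<lambda>x. g x - f x) < e1) \<longrightarrow> g \<in> a"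
        using bspec[OF Int.IH(1) IntD1[OF f]] by blast
      obtain Q2 e2 where 2: "finite Q2" "Q2 \<subseteq> P" "(e2::real) > 0" "\<forall>g\<in>X. (\<forall>p\<in>Q2. p (\<lambda>x. g x - f x) < e2) \<longrightarrow> g \<in> b"
        using bspec[OF Int.IH(2) IntD2[OF f]] by blast
      show "\<exists>Q e. finite Q \<and> Q \<subseteq> P \<and> e > 0 \<and> (\<forall>g\<in>X. (\<forall>p\<in>Q. p (\<lambda>x. g x - f x) < e) \<longrightarrow> g \<in> a \<inter> b)"
      proof (intro exI conjI ballI impI)
        show "finite (Q1 \<union> Q2)" "Q1 \<union> Q2 \<subseteq> P" "min e1 e2 > 0" using 1(1-3) 2(1-3) by auto
        fix g assume g: "g \<in> X" "\<forall>p\<in>Q1 \<union> Q2. p (\<lambda>x. g x - f x) < min e1 e2"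
        then have "\<forall>p\<in>Q1. p (\<lambda>x. g x - f x) < e1" "\<forall>p\<in>Q2. p (\<lambda>x. g x - f x) < e2" by simp_all
        then show "g \<in> a \<inter> b" using 1(4) 2(4) g(1) by blast
      qed
    qed
  next
    case (UN K)
    show ?case
    proof
      fix f assume "f \<in> \<Union>K"
      then obtain k where k: "k \<in> K" "f \<in> k" by blast
      obtain Q e where 1: "finite Q" "Q \<subseteq> P" "(e::real) > 0" "\<forall>g\<in>X. (\<forall>p\<in>Q. p (\<lambda>x. g x - f x) < e) \<longrightarrow> g \<in> k"
        using bspec[OF UN.IH[OF k(1)] k(2)] by blast
      then show "\<exists>Q e. finite Q \<and> Q \<subseteq> P \<and> e > 0 \<and> (\<forall>g\<in>X. (\<forall>p\<in>Q. p (\<lambda>x. g x - f x) < e) \<longrightarrow> g \<in> \<Union>K)"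
        using k(1) by blast
    qed
  next
    case (Basis s)
    then obtain p f0 e0 where s: "s = {g \<in> X. p (\<lambda>x. g x - f0 x) < e0}" "p \<in> P" "f0 \<in> X" "0 < e0"
      by blast
    show ?case
    proof
      fix f assume f: "f \<in> s"
      have fX: "f \<in> X" using f s by auto
      have "g \<in> s" if g: "g \<in> X" "p (\<lambda>x. g x - f x) < e0 - p (\<lambda>x. f x - f0 x)" for g
      proof -
        have "p (\<lambda>x. (g x - f x) + (f x - f0 x)) \<le> p (\<lambda>x. g x - f x) + p (\<lambda>x. f x - f0 x)"
          by (rule seminorm_on_add[OF P[OF s(2)] X[OF g(1) fX] X[OF fX s(3)]])
        then show ?thesis using g s by auto
      qed
      then show "\<exists>Q e. finite Q \<and> Q \<subseteq> P \<and> e > 0 \<and> (\<forall>g\<in>X. (\<forall>p\<in>Q. p (\<lambda>x. g x - f x) < e) \<longrightarrow> g \<in> s)"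
        using f s by (intro exI[of _ "{p}"] exI[of _ "e0 - p (\<lambda>x. f x - f0 x)"]) auto
    qed
  qed auto
  from bspec[OF this assms(2)] obtain Q e where
    "finite Q" "Q \<subseteq> P" "(e::real) > 0" "\<forall>g\<in>X. (\<forall>p\<in>Q. p (\<lambda>x. g x - f x) < e) \<longrightarrow> g \<in> V"
    by (elim exE conjE)
  then show ?thesis by (intro that[of Q e]) simp_all
qed

lemma seminorm_on_nonneg:
  assumes "seminorm_on X p" "f \<in> X" "\<And>c f. f \<in> X \<Longrightarrow> (\<lambda>x. c * f x) \<in> X"
  shows "0 \<le> p f"
proof -
  have "p (\<lambda>x. f x + (-1) * f x) \<le> p f + p (\<lambda>x. (-1) * f x)"
    by (rule seminorm_on_add[OF assms(1,2) assms(3)[OF assms(2)]])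
  moreover have "p (\<lambda>x. f x + (-1) * f x) = 0" using seminorm_on_zero[OF assms(1,2)] by simp
  moreover have "p (\<lambda>x. (-1) * f x) = p f" using seminorm_on_cmult[OF assms(1,2), of "-1"] by simp
  ultimately show ?thesis by simp
qed

text \<open>Finitely many generating seminorms control \<open>h\<close> near 0, homogeneity turns
  this into an inequality, and by the definition of \<open>test_seminorms\<close> each of them is
  dominated on \<open>K\<close> by finitely many sup norms of derivatives.\<close>

lemma antidual_test_bound:
  assumes "h \<in> antidual (test_topology U)" "compact K" "K \<subseteq> U"
  obtains C N where "C \<ge> 0" "\<And>f. f \<in> test_space U \<Longrightarrow> supp f \<subseteq> K \<Longrightarrow>
      cmod (h f) \<le> C * (\<Sum>n\<le>N. SUP x. cmod (nderiv n f x))"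
proof -
  let ?X = "test_space U"
  have c: "continuous_map (lc_topology ?X (test_seminorms U)) euclidean h"
    and h1: "\<And>c f. f \<in> ?X \<Longrightarrow> h (\<lambda>x. c * f x) = cnj c * h f"
    using assms(1) unfolding antidual_iff topspace_test_topology unfolding test_topology_def by auto
  have h0: "h (\<lambda>x. 0) = 0" using h1[OF zero_in_test_space, of 0] by simp
  have tX: "topspace (lc_topology ?X (test_seminorms U)) = ?X"
    using topspace_test_topology unfolding test_topology_def .
  have o: "openin (lc_topology ?X (test_seminorms U)) {f \<in> ?X. h f \<in> ball 0 1}"
    using openin_continuous_map_preimage[OF c, of "ball 0 1"] tX by simp
  obtain Q e where Q: "finite Q" "Q \<subseteq> test_seminorms U" "(e::real) > 0"
    "\<And>g. g \<in> ?X \<Longrightarrow> (\<And>p. p \<in> Q \<Longrightarrow> p (\<lambda>x. g x - 0) < e) \<Longrightarrow> g \<in> {f \<in> ?X. h f \<in> ball 0 1}"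
    by (rule lc_topology_nhd[OF o, of "\<lambda>x. 0"])
      (auto simp: h0 zero_in_test_space test_space_diff test_seminorms_def)
  have sq: "seminorm_on ?X p" if "p \<in> Q" for p
    using that Q(2) by (auto simp: test_seminorms_def)
  have pnn: "0 \<le> p f" if "p \<in> Q" "f \<in> ?X" for p f
    by (rule seminorm_on_nonneg[OF sq[OF that(1)] that(2)]) (rule test_space_cmult)
  have b: "cmod (h f) \<le> 2 / e * (\<Sum>p\<in>Q. p f)" if f: "f \<in> ?X" for f
  proof (rule field_le_epsilon)
    fix d :: real assume d: "d > 0"
    \<comment> \<open>The summand with \<open>d\<close> keeps \<open>s\<close> positive even if all
      seminorms vanish at \<open>f\<close>, and it becomes the slack of
      \<open>field_le_epsilon\<close>. Scaling \<open>f\<close> by \<open>e / (2 * s)\<close> brings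
      every seminorm in \<open>Q\<close> down to at most \<open>e / 2\<close>.\<close>
    define s where "s = (\<Sum>p\<in>Q. p f) + d * e / 2"
    have s0: "(\<Sum>p\<in>Q. p f) \<ge> 0" using pnn f by (intro sum_nonneg) auto
    then have s: "s > 0" using d Q(3) unfolding s_def by (intro add_nonneg_pos) auto
    let ?c = "of_real (e / (2 * s)) :: complex"
    have "(\<lambda>x. ?c * f x) \<in> {f \<in> ?X. h f \<in> ball 0 1}"
    proof (rule Q(4))
      fix p assume p: "p \<in> Q"
      have "p f \<le> (\<Sum>p\<in>Q. p f)" using member_le_sum[of p Q "\<lambda>p. p f"] p Q(1) pnn f by auto
      then have "p f \<le> s" unfolding s_def using d Q(3) by (simp add: add_increasing2)
      moreover have "p (\<lambda>x. ?c * f x - 0) = e / (2 * s) * p f"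
        using seminorm_on_cmult[OF sq[OF p] f, of ?c] s Q(3) by (simp add: norm_mult norm_divide)
      moreover have "e / (2 * s) * p f \<le> e / (2 * s) * s"
        using s Q(3) \<open>p f \<le> s\<close> by (intro mult_left_mono) auto
      moreover have "e / (2 * s) * s < e" using s Q(3) by simp
      ultimately show "p (\<lambda>x. ?c * f x - 0) < e" by linarith
    qed (rule test_space_cmult[OF f])
    then have "cmod (h (\<lambda>x. ?c * f x)) < 1" by simp
    then have "e / (2 * s) * cmod (h f) < 1"
      unfolding h1[OF f] using s Q(3) by (simp add: norm_mult norm_divide)
    then have "cmod (h f) < 2 / e * s" using s Q(3) by (simp add: field_simps)
    also have "\<dots> = 2 / e * (\<Sum>p\<in>Q. p f) + d" using Q(3) by (simp add: s_def field_simps)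
    finally show "cmod (h f) \<le> 2 / e * (\<Sum>p\<in>Q. p f) + d" by simp
  qed
  have "\<forall>p\<in>Q. \<exists>C N. \<forall>f\<in>?X. supp f \<subseteq> K \<longrightarrow> p f \<le> C * (\<Sum>n\<le>(N::nat). SUP x. cmod (nderiv n f x))"
    using Q(2) assms(2,3) unfolding test_seminorms_def by blast
  then obtain C N where CN: "\<And>p f. p \<in> Q \<Longrightarrow> f \<in> ?X \<Longrightarrow> supp f \<subseteq> K \<Longrightarrow>
      p f \<le> C p * (\<Sum>n\<le>(N p::nat). SUP x. cmod (nderiv n f x))" by metis
  \<comment> \<open>A common order for all of \<open>Q\<close>; inserting 0 covers an empty
    \<open>Q\<close>.\<close>
  define M where "M = Max (insert 0 (N ` Q))"
  define C' where "C' = 2 / e * (\<Sum>p\<in>Q. \<bar>C p\<bar>)"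
  show ?thesis
  proof (rule that)
    show "C' \<ge> 0" unfolding C'_def using Q(3) by (intro mult_nonneg_nonneg sum_nonneg) auto
    fix f assume f: "f \<in> ?X" "supp f \<subseteq> K"
    have nn: "0 \<le> (SUP x. cmod (nderiv n f x))" for n
      by (rule order_trans[OF norm_ge_zero norm_nderiv_le_SUP[OF f(1)]])
    have "p f \<le> \<bar>C p\<bar> * (\<Sum>n\<le>M. SUP x. cmod (nderiv n f x))" if p: "p \<in> Q" for p
    proof -
      have "p f \<le> C p * (\<Sum>n\<le>N p. SUP x. cmod (nderiv n f x))" by (rule CN[OF p f])
      also have "\<dots> \<le> \<bar>C p\<bar> * (\<Sum>n\<le>N p. SUP x. cmod (nderiv n f x))"
        by (intro mult_right_mono sum_nonneg nn) auto
      also have "\<dots> \<le> \<bar>C p\<bar> * (\<Sum>n\<le>M. SUP x. cmod (nderiv n f x))"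
        using p Q(1) nn unfolding M_def by (intro mult_left_mono sum_mono2) auto
      finally show ?thesis .
    qed
    then have "(\<Sum>p\<in>Q. p f) \<le> (\<Sum>p\<in>Q. \<bar>C p\<bar> * (\<Sum>n\<le>M. SUP x. cmod (nderiv n f x)))"
      by (rule sum_mono)
    then have "2 / e * (\<Sum>p\<in>Q. p f) \<le> 2 / e * ((\<Sum>p\<in>Q. \<bar>C p\<bar>) * (\<Sum>n\<le>M. SUP x. cmod (nderiv n f x)))"
      using Q(3) by (intro mult_left_mono) (auto simp: sum_distrib_right)
    then show "cmod (h f) \<le> C' * (\<Sum>n\<le>M. SUP x. cmod (nderiv n f x))"
      using b[OF f(1)] by (simp add: C'_def)
  qed
qed

text \<open>Compatibility with differences lets the bound be applied to \<open>g - f\<close>, so the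
  estimate at 0 gives continuity at every \<open>f\<close>.\<close>

lemma continuous_map_lc_topology:
  assumes T: "topspace (lc_topology X P) = X"
    and Q: "finite Q" "Q \<subseteq> P"
    and X: "\<And>f g. f \<in> X \<Longrightarrow> g \<in> X \<Longrightarrow> (\<lambda>x. f x - g x) \<in> X"
    and zero: "\<And>p f. p \<in> Q \<Longrightarrow> f \<in> X \<Longrightarrow> p (\<lambda>x. 0) = 0"
    and h: "\<And>f g. f \<in> X \<Longrightarrow> g \<in> X \<Longrightarrow> h (\<lambda>x. f x - g x) = h f - (h g :: complex)"
    and b: "\<And>f. f \<in> X \<Longrightarrow> cmod (h f) \<le> C * (\<Sum>p\<in>Q. p f)" and C: "C \<ge> 0"
  shows "continuous_map (lc_topology X P) euclidean h"
  unfolding continuous_map_def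
proof (intro conjI allI impI)
  fix V assume "openin euclidean (V :: complex set)"
  then have V: "open V" by simp
  show "openin (lc_topology X P) {f \<in> topspace (lc_topology X P). h f \<in> V}"
  proof (subst openin_subopen, intro ballI)
    fix f assume "f \<in> {f \<in> topspace (lc_topology X P). h f \<in> V}"
    then have f: "f \<in> X" "h f \<in> V" using T by auto
    obtain e where e: "e > 0" "ball (h f) e \<subseteq> V" using V f(2) openE by blast
    \<comment> \<open>The \<open>+ 1\<close> avoids division by zero and makes the last inequality
      strict.\<close>
    define d where "d = e / (C * card Q + 1)"
    have dp: "C * card Q + 1 > 0" using C by (intro add_nonneg_pos mult_nonneg_nonneg) auto
    have d: "d > 0" unfolding d_def using e(1) dp by simp
    let ?W = "X \<inter> (\<Inter>p\<in>Q. {g \<in> X. p (\<lambda>x. g x - f x) < d})"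
    have "openin (lc_topology X P) {g \<in> X. p (\<lambda>x. g x - f x) < d}" if "p \<in> Q" for p
      unfolding lc_topology_def using that Q(2) f(1) d
      by (intro topology_generated_by_Basis) blast
    moreover have "openin (lc_topology X P) X" using openin_topspace[of "lc_topology X P"] T by simp
    ultimately have "openin (lc_topology X P) ?W"
      using Q(1) by (intro openin_Int_Inter[of "(\<lambda>p. {g \<in> X. p (\<lambda>x. g x - f x) < d}) ` Q"]) auto
    moreover have "f \<in> ?W" using f(1) d by (simp add: zero[OF _ f(1)])
    moreover have "?W \<subseteq> {f \<in> topspace (lc_topology X P). h f \<in> V}"
    proof
      fix g assume g: "g \<in> ?W"
      have gX: "g \<in> X" using g by auto
      have "(\<Sum>p\<in>Q. p (\<lambda>x. g x - f x)) \<le> card Q * d"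
        by (rule sum_bounded_above) (use g in \<open>auto intro: less_imp_le\<close>)
      moreover have "cmod (h g - h f) \<le> C * (\<Sum>p\<in>Q. p (\<lambda>x. g x - f x))"
        using b[OF X[OF gX f(1)]] h[OF gX f(1)] by simp
      ultimately have "cmod (h g - h f) \<le> C * (card Q * d)"
        using mult_left_mono[OF _ C] order_trans by blast
      also have "\<dots> < e"
      proof -
        have "(C * card Q + 1) * d = e" unfolding d_def using dp by simp
        then show ?thesis using d by (simp add: algebra_simps)
      qed
      finally have "h g \<in> V" using e(2) by (auto simp: dist_norm norm_minus_commute)
      then show "g \<in> {f \<in> topspace (lc_topology X P). h f \<in> V}" using gX T by simp
    qed
    ultimately show "\<exists>W. openin (lc_topology X P) W \<and> f \<in> W \<and> W \<subseteq> {f \<in> topspace (lc_topology X P). h f \<in> V}"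
      by blast
  qed
qed auto

section \<open>Laplace convolutions of test functions\<close>

text \<open>A fixed interval in place of \<open>{0..t}\<close> lets one differentiate under the
  integral sign without boundary terms. \<open>laplace_conv_eq_conv_on\<close> identifies the two
  when \<open>{a..b}\<close> contains the support of \<open>f\<close> and \<open>g\<close> vanishes
  on the nonpositive axis.\<close>

definition conv_on :: "real \<Rightarrow> real \<Rightarrow> (real \<Rightarrow> complex) \<Rightarrow> (real \<Rightarrow> complex) \<Rightarrow> real \<Rightarrow> complex" where
  "conv_on a b f g t = integral {a..b} (\<lambda>s. f s * g (t - s))"

lemma conv_on_integrable:
  fixes f g :: "real \<Rightarrow> complex"
  assumes "continuous_on UNIV f" "continuous_on UNIV g"
  shows "(\<lambda>s. f s * g (t - s)) integrable_on {a..b}"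
  by (intro integrable_continuous_real continuous_intros continuous_on_subset[OF assms(1)]
      continuous_on_compose2[OF assms(2)]) auto

lemma conv_on_deriv:
  assumes f: "continuous_on UNIV f" and g: "\<And>x. (g has_vector_derivative g' x) (at x)"
    and g': "continuous_on UNIV g'"
  shows "(conv_on a b f g has_vector_derivative conv_on a b f g' t) (at t)"
proof -
  have gc: "continuous_on UNIV g"
    by (meson continuous_at_imp_continuous_on has_vector_derivative_continuous g)
  have "((\<lambda>t. integral (cbox a b) (\<lambda>s. f s * g (t - s))) has_vector_derivative
      integral (cbox a b) (\<lambda>s. f s * g' (t - s))) (at t within UNIV)"
  proof (rule leibniz_rule_vector_derivative[where fx = "\<lambda>t s. f s * g' (t - s)" and f = "\<lambda>t s. f s * g (t - s)"])
    fix x s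
    have "((\<lambda>x. g (x - s)) has_vector_derivative g' (x - s)) (at x)"
    proof -
      have "((\<lambda>x. x - s) has_vector_derivative 1 - 0) (at x)"
        by (intro has_vector_derivative_diff has_vector_derivative_id has_vector_derivative_const)
      from vector_diff_chain_at[OF this g] show ?thesis by (simp add: o_def)
    qed
    then show "((\<lambda>x. f s * g (x - s)) has_vector_derivative f s * g' (x - s)) (at x within UNIV)"
      by (rule bounded_linear.has_vector_derivative[OF bounded_linear_mult_right])
  next
    fix x show "(\<lambda>s. f s * g (x - s)) integrable_on cbox a b"
      using conv_on_integrable[OF f gc] by simp
  next
    show "continuous_on (UNIV \<times> cbox a b) (\<lambda>(t, s). f s * g' (t - s))"
      unfolding case_prod_beta
      by (intro continuous_intros continuous_on_compose2[OF f] continuous_on_compose2[OF g']) auto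
  qed auto
  then show ?thesis unfolding conv_on_def[abs_def] by simp
qed

text \<open>All derivatives are put on the second factor, so that the first need only be continuous.
  The control of the remainder in \<open>local_bound_pos\<close> depends on this choice.\<close>

lemma conv_on_nderiv_deriv:
  "continuous_on UNIV f \<Longrightarrow> smooth g \<Longrightarrow>
    (conv_on a b f (nderiv n g) has_vector_derivative conv_on a b f (nderiv (Suc n) g) t) (at t)"
  by (intro conv_on_deriv smooth_nderiv_deriv continuous_nderiv)

lemma smooth_conv_on: "continuous_on UNIV f \<Longrightarrow> smooth g \<Longrightarrow> smooth (conv_on a b f g)"
  by (rule smooth_derivs[of "\<lambda>n. conv_on a b f (nderiv n g)"]) (auto intro: conv_on_nderiv_deriv)

lemma nderiv_conv_on: "continuous_on UNIV f \<Longrightarrow> smooth g \<Longrightarrow> nderiv n (conv_on a b f g) = conv_on a b f (nderiv n g)"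
  by (rule nderiv_unique[of "\<lambda>n. conv_on a b f (nderiv n g)"]) (auto intro: conv_on_nderiv_deriv)

lemma conv_on_zero_outside:
  assumes "\<And>x. x \<notin> {c..d} \<Longrightarrow> f x = 0" "\<And>x. x \<notin> {c'..d'} \<Longrightarrow> g x = 0" "t \<notin> {c + c'..d + d'}"
  shows "conv_on a b f g t = 0"
proof -
  have "f s * g (t - s) = 0" for s
    using assms(1)[of s] assms(2)[of "t - s"] assms(3) by (cases "s \<in> {c..d}") auto
  then have "(\<lambda>s. f s * g (t - s)) = (\<lambda>s. 0)" by (rule ext)
  then show ?thesis by (simp add: conv_on_def)
qed

lemma conv_on_superset:
  assumes "continuous_on UNIV f" "continuous_on UNIV g"
    and "\<And>x. x \<notin> {a..b} \<Longrightarrow> f x = 0" "{a..b} \<subseteq> {c..d}"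
  shows "conv_on a b f g = conv_on c d f g"
proof
  fix t
  have "((\<lambda>s. f s * g (t - s)) has_integral conv_on a b f g t) {a..b}"
    unfolding conv_on_def by (intro integrable_integral conv_on_integrable assms)
  then have "((\<lambda>s. f s * g (t - s)) has_integral conv_on a b f g t) {c..d}"
    by (rule has_integral_on_superset) (use assms(3,4) in auto)
  from integral_unique[OF this] show "conv_on a b f g t = conv_on c d f g t" by (simp add: conv_on_def)
qed

lemma conv_on_test_space:
  assumes "continuous_on UNIV f" "smooth g"
    and "\<And>x. x \<notin> {c..d} \<Longrightarrow> f x = 0" "\<And>x. x \<notin> {c'..d'} \<Longrightarrow> g x = 0" "0 < c" "0 < c'"
  shows "conv_on a b f g \<in> test_space {0<..}"
  by (rule test_spaceI[OF smooth_conv_on[OF assms(1,2)] conv_on_zero_outside[OF assms(3,4)]]) (use assms(5,6) in auto)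

lemma lborel_integral_eq_integral:
  fixes u :: "real \<Rightarrow> 'a::euclidean_space"
  assumes "continuous_on {a..b} u" "\<And>x. x \<notin> {a..b} \<Longrightarrow> v x = 0" "\<And>x. x \<in> {a..b} \<Longrightarrow> v x = u x"
  shows "(LINT x|lborel. v x) = integral {a..b} u"
proof -
  have "(LINT x|lborel. v x) = (LINT x:{a..b}|lborel. u x)"
    unfolding set_lebesgue_integral_def
    by (rule Bochner_Integration.integral_cong) (use assms(2,3) in \<open>auto simp: indicator_def\<close>)
  then show ?thesis
    using set_borel_integral_eq_integral(2)[OF borel_integrable_atLeastAtMost'[OF assms(1)]] by simp
qed

lemma laplace_conv_eq_conv_on:
  assumes "continuous_on UNIV f" "continuous_on UNIV g"
    and "\<And>x. x \<notin> {a..b} \<Longrightarrow> f x = 0" "\<And>x. x \<le> 0 \<Longrightarrow> g x = 0" "0 < a"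
  shows "laplace_conv f g = conv_on a b f g"
proof
  fix t
  show "laplace_conv f g t = conv_on a b f g t"
    unfolding laplace_conv_def conv_on_def set_lebesgue_integral_def
  proof (rule lborel_integral_eq_integral)
    show "continuous_on {a..b} (\<lambda>s. f s * g (t - s))"
      by (intro continuous_intros continuous_on_subset[OF assms(1)]
        continuous_on_compose2[OF assms(2)]) auto
  qed (use assms in \<open>auto simp: indicator_def\<close>)
qed

lemma l2norm_pos_bound:
  assumes "continuous_on UNIV f" "\<And>x. x \<notin> {a..b} \<Longrightarrow> f x = 0" "0 < a" "a \<le> b"
    and "\<And>x. cmod (f x) \<le> M"
  shows "(l2norm_pos f)\<^sup>2 \<le> (b - a) * M\<^sup>2"
proof -
  have i: "(\<lambda>t. (cmod (f t))\<^sup>2) integrable_on {a..b}"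
    by (intro integrable_continuous_real continuous_intros continuous_on_subset[OF assms(1)]) auto
  have "(LINT t:{0<..}|lborel. (cmod (f t))\<^sup>2) = integral {a..b} (\<lambda>t. (cmod (f t))\<^sup>2)"
    unfolding set_lebesgue_integral_def
    by (rule lborel_integral_eq_integral)
     (use assms in \<open>auto simp: indicator_def intro!: continuous_intros continuous_on_subset[OF assms(1)]\<close>)
  moreover have "0 \<le> integral {a..b} (\<lambda>t. (cmod (f t))\<^sup>2)"
    by (rule integral_nonneg[OF i]) auto
  moreover have "integral {a..b} (\<lambda>t. (cmod (f t))\<^sup>2) \<le> integral {a..b} (\<lambda>t. M\<^sup>2)"
    by (rule integral_le[OF i]) (auto intro!: power_mono assms)
  ultimately show ?thesis using assms(4) by (simp add: l2norm_pos_def)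
qed

text \<open>Expanding \<open>Q c\<close> gives terms with coefficients \<open>1\<close>,
  \<open>c\<close>, \<open>cnj c\<close> and \<open>|c|^2\<close>. Averaging against
  \<open>cnj c\<close> over the fourth roots of unity keeps only the one with \<open>c\<close>,
  which is \<open>f s * g (t - s)\<close> because \<open>f\<close> enters conjugated.\<close>

lemma polarization_conv:
  assumes f: "continuous_on UNIV f" and g: "continuous_on UNIV g"
    and Q: "\<And>c. Q c = conv_on a b (\<lambda>s. cnj (cnj (f s) + c * g s)) (\<lambda>s. cnj (f s) + c * g s)"
  shows "conv_on a b f g = (\<lambda>t. 1/4 * Q 1 t + (- \<i>/4 * Q \<i> t + (- (1/4) * Q (-1) t + \<i>/4 * Q (-\<i>) t)))"
proof
  fix t
  have q: "((\<lambda>s. cnj (cnj (f s) + c * g s) * (cnj (f (t - s)) + c * g (t - s))) has_integral Q c t) {a..b}" for c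
    unfolding Q conv_on_def
    by (intro integrable_integral conv_on_integrable[of "\<lambda>s. cnj (cnj (f s) + c * g s)" "\<lambda>s. cnj (f s) + c * g s"]
        continuous_intros f g)
  let ?q = "\<lambda>c s. cnj (cnj (f s) + c * g s) * (cnj (f (t - s)) + c * g (t - s))"
  have "((\<lambda>s. 1/4 * ?q 1 s + (- \<i>/4 * ?q \<i> s + (- (1/4) * ?q (-1) s + \<i>/4 * ?q (-\<i>) s))) has_integral
     (1/4 * Q 1 t + (- \<i>/4 * Q \<i> t + (- (1/4) * Q (-1) t + \<i>/4 * Q (-\<i>) t)))) {a..b}"
    by (intro has_integral_add has_integral_mult_right q)
  moreover have "1/4 * ?q 1 s + (- \<i>/4 * ?q \<i> s + (- (1/4) * ?q (-1) s + \<i>/4 * ?q (-\<i>) s)) = f s * g (t - s)" for s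
    by (simp add: algebra_simps)
  ultimately show "conv_on a b f g t = 1/4 * Q 1 t + (- \<i>/4 * Q \<i> t + (- (1/4) * Q (-1) t + \<i>/4 * Q (-\<i>) t))"
    unfolding conv_on_def using integral_unique by simp
qed

text \<open>Integrate the derivative of \<open>- \<phi> (t - s) * (1 - dstep a a s)\<close> over
  \<open>{a/2..2*a}\<close>: the upper end contributes nothing, the lower end
  \<open>\<phi> (t - a/2)\<close>. With \<open>1 - dstep a a\<close> in place of
  \<open>\<theta>\<close> the identity would be exact; smoothing its jump at \<open>a/2\<close>
  changes the integrand only on an interval of length \<delta>.\<close>

lemma cutoff_identity:
  assumes "smooth \<phi>" "a > 0" "0 < \<delta>" "\<delta> \<le> a / 2" "\<And>x. cmod (nderiv 1 \<phi> x) \<le> B"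
  defines "\<theta> \<equiv> \<lambda>s. dstep (a/2) \<delta> s * (1 - dstep a a s)"
  shows "cmod (conv_on (a/2) (2*a) \<theta> (nderiv 1 \<phi>) t + conv_on (a/2) (2*a) (nderiv 1 (dstep a a)) \<phi> t - \<phi> (t - a/2)) \<le> B * \<delta>"
proof -
  let ?d = "dstep a a" and ?S = "dstep (a/2) \<delta>"
  define v where "v s = - (\<phi> (t - s) * (1 - ?d s))" for s
  define v' where "v' s = (1 - ?d s) * nderiv 1 \<phi> (t - s) + nderiv 1 ?d s * \<phi> (t - s)" for s
  have co: "continuous_on A \<phi>" "continuous_on A (nderiv 1 \<phi>)" "continuous_on A ?d" "continuous_on A (nderiv 1 ?d)" "continuous_on A ?S" for A
    using assms(1) by (auto intro: smooth_continuous continuous_nderiv smooth_dstep)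
  have "(v has_vector_derivative v' s) (at s within {a/2..2*a})" for s
  proof -
    have "((\<lambda>s. \<phi> (t - s)) has_vector_derivative - nderiv 1 \<phi> (t - s)) (at s)"
    proof -
      have "((\<lambda>s. t - s) has_vector_derivative 0 - 1) (at s)"
        by (intro has_vector_derivative_diff has_vector_derivative_id has_vector_derivative_const)
      from vector_diff_chain_at[OF this smooth_nderiv_deriv[OF assms(1), of 0]] show ?thesis
        by (simp add: o_def)
    qed
    moreover have "((\<lambda>s. 1 - ?d s) has_vector_derivative 0 - nderiv 1 ?d s) (at s)"
      using smooth_nderiv_deriv[OF smooth_dstep[of a a], of 0 s] by (intro derivative_intros) auto
    ultimately have "(v has_vector_derivative
        - (\<phi> (t - s) * (0 - nderiv 1 ?d s) + - nderiv 1 \<phi> (t - s) * (1 - ?d s))) (at s)"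
      unfolding v_def[abs_def] by (intro has_vector_derivative_minus has_vector_derivative_mult)
    then have "(v has_vector_derivative v' s) (at s)"
      by (simp add: v'_def algebra_simps)
    then show ?thesis by (rule has_vector_derivative_at_within)
  qed
  then have "(v' has_integral v (2*a) - v (a/2)) {a/2..2*a}"
    using assms(2) by (intro fundamental_theorem_of_calculus) auto
  moreover have "v (2*a) - v (a/2) = \<phi> (t - a/2)"
    using assms(2) by (simp add: v_def dstep_0 dstep_1)
  ultimately have i1: "(v' has_integral \<phi> (t - a/2)) {a/2..2*a}" by simp
  have i2: "((\<lambda>s. \<theta> s * nderiv 1 \<phi> (t - s)) has_integral conv_on (a/2) (2*a) \<theta> (nderiv 1 \<phi>) t) {a/2..2*a}"
    unfolding conv_on_def \<theta>_def by (intro integrable_integral conv_on_integrable continuous_intros co)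
  have i3: "((\<lambda>s. nderiv 1 ?d s * \<phi> (t - s)) has_integral conv_on (a/2) (2*a) (nderiv 1 ?d) \<phi> t) {a/2..2*a}"
    unfolding conv_on_def by (intro integrable_integral conv_on_integrable continuous_intros co)
  \<comment> \<open>The change of the integrand caused by the extra factor \<open>?S\<close> in
    \<open>\<theta>\<close>; it vanishes as soon as \<open>?S\<close> has reached 1.\<close>
  define w where "w s = - ((1 - ?S s) * (1 - ?d s) * nderiv 1 \<phi> (t - s))" for s
  have "((\<lambda>s. \<theta> s * nderiv 1 \<phi> (t - s) + nderiv 1 ?d s * \<phi> (t - s) - v' s) has_integral
     (conv_on (a/2) (2*a) \<theta> (nderiv 1 \<phi>) t + conv_on (a/2) (2*a) (nderiv 1 ?d) \<phi> t - \<phi> (t - a/2))) {a/2..2*a}"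
    by (intro has_integral_add has_integral_diff i1 i2 i3)
  moreover have "\<theta> s * nderiv 1 \<phi> (t - s) + nderiv 1 ?d s * \<phi> (t - s) - v' s = w s" for s
    by (simp add: \<theta>_def v'_def w_def algebra_simps)
  ultimately have i4: "(w has_integral
     (conv_on (a/2) (2*a) \<theta> (nderiv 1 \<phi>) t + conv_on (a/2) (2*a) (nderiv 1 ?d) \<phi> t - \<phi> (t - a/2))) {a/2..2*a}"
    by simp
  have w0: "w s = 0" if "s \<ge> a/2 + \<delta>" for s
    using that assms(3) by (simp add: w_def dstep_1)
  have wi: "w integrable_on {a/2..2*a}" using i4 by blast
  have "integral {a/2..2*a} w = integral {a/2..a/2+\<delta>} w + integral {a/2+\<delta>..2*a} w"
    by (rule Henstock_Kurzweil_Integration.integral_combine[symmetric]) (use assms(2-4) wi in auto)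
  also have "integral {a/2+\<delta>..2*a} w = integral {a/2+\<delta>..2*a} (\<lambda>s. 0)"
    by (rule integral_cong) (use w0 in auto)
  finally have eq: "integral {a/2..2*a} w = integral {a/2..a/2+\<delta>} w" by simp
  have wc: "continuous_on A w" for A
    unfolding w_def by (intro continuous_intros co continuous_on_compose2[OF co(2)[of UNIV]]) auto
  have "cmod (w s) \<le> 1 * 1 * B" for s
    unfolding w_def norm_minus_cancel norm_mult
    by (intro mult_mono norm_dstep assms(5) mult_nonneg_nonneg) auto
  then have "cmod (integral {a/2..a/2+\<delta>} w) \<le> B * (a/2 + \<delta> - a/2)"
    using assms(2,3) wc by (intro integral_bound) auto
  then show ?thesis using integral_unique[OF i4] eq by simp
qed

locale hankel_form =
  fixes h :: "(real \<Rightarrow> complex) \<Rightarrow> complex" and C :: real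
  assumes h: "h \<in> antidual (test_topology {0<..})" and C: "0 \<le> C"
    and bound: "\<And>f. f \<in> test_space {0<..} \<Longrightarrow>
      cmod (h (laplace_conv (\<lambda>s. cnj (f s)) f)) \<le> C * (l2norm_pos f)\<^sup>2"
begin

lemma h_add: "f \<in> test_space {0<..} \<Longrightarrow> g \<in> test_space {0<..} \<Longrightarrow> h (\<lambda>x. f x + g x) = h f + h g"
  using h by (simp add: antidual_iff)

lemma h_cmult: "f \<in> test_space {0<..} \<Longrightarrow> h (\<lambda>x. c * f x) = cnj c * h f"
  using h by (simp add: antidual_iff)

lemma h_diff: "f \<in> test_space {0<..} \<Longrightarrow> g \<in> test_space {0<..} \<Longrightarrow> h (\<lambda>x. f x - g x) = h f - h g"
  using h_add[of f "\<lambda>x. - 1 * g x"] h_cmult[of g "-1"] test_space_cmult[of g _ "-1"] by simp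

lemma h_zero: "h (\<lambda>x. 0) = 0"
  using h_cmult[OF zero_in_test_space, of 0] by simp

lemma h_sum:
  "(\<And>i. i \<in> I \<Longrightarrow> f i \<in> test_space {0<..}) \<Longrightarrow> h (\<lambda>x. \<Sum>i\<in>I. f i x) = (\<Sum>i\<in>I. h (f i))"
  by (induction I rule: infinite_finite_induct) (simp_all add: h_zero h_add test_space_sum)

text \<open>Each of the four functions \<open>u c\<close> is bounded by 2, so its squared norm is at
  most \<open>4 * (b - a)\<close>; the four weights \<open>1/4\<close> add up to 1.\<close>

lemma conv_bound_1:
  assumes sm: "smooth f" "smooth g" and ab: "0 < a" "a \<le> b"
    and z: "\<And>x. x \<notin> {a..b} \<Longrightarrow> f x = 0" "\<And>x. x \<notin> {a..b} \<Longrightarrow> g x = 0"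
    and le: "\<And>x. cmod (f x) \<le> 1" "\<And>x. cmod (g x) \<le> 1"
  shows "cmod (h (conv_on a b f g)) \<le> 4 * C * (b - a)"
proof -
  let ?T = "test_space {0<..}"
  define u where "u c = (\<lambda>s. cnj (f s) + c * g s)" for c
  define Q where "Q c = conv_on a b (\<lambda>s. cnj (cnj (f s) + c * g s)) (\<lambda>s. cnj (f s) + c * g s)" for c
  have us: "smooth (u c)" for c
    unfolding u_def by (intro smooth_add smooth_mult smooth_cnj smooth_const sm)
  have uz: "u c x = 0" if "x \<notin> {a..b}" for c x
    using z[OF that] by (simp add: u_def)
  have uT: "u c \<in> ?T" for c
    by (rule test_spaceI[OF us uz]) (use ab in auto)
  have Qu: "Q c = conv_on a b (\<lambda>s. cnj (u c s)) (u c)" for c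
    by (simp add: Q_def u_def)
  have Qlc: "Q c = laplace_conv (\<lambda>s. cnj (u c s)) (u c)" for c
    unfolding Qu
    by (rule laplace_conv_eq_conv_on[symmetric])
     (use uz ab in \<open>auto intro!: smooth_continuous smooth_cnj us\<close>)
  have QT: "Q c \<in> ?T" for c
    unfolding Qu
    by (rule conv_on_test_space[where c = a and d = b and c' = a and d' = b])
      (use uz ab in \<open>auto intro!: smooth_continuous smooth_cnj us\<close>)
  have Qb: "cmod (h (Q c)) \<le> C * (4 * (b - a))" if "cmod c = 1" for c
  proof -
    have "cmod (u c x) \<le> 2" for x
      unfolding u_def by (rule norm_triangle_le) (use le[of x] that in \<open>simp add: norm_mult\<close>)
    then have "(l2norm_pos (u c))\<^sup>2 \<le> (b - a) * 2\<^sup>2"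
      by (intro l2norm_pos_bound smooth_continuous us uz ab) auto
    then have "C * (l2norm_pos (u c))\<^sup>2 \<le> C * (4 * (b - a))"
      by (intro mult_left_mono C) auto
    then show ?thesis using bound[OF uT, of c] unfolding Qlc by linarith
  qed
  have eq: "conv_on a b f g = (\<lambda>t. 1/4 * Q 1 t + (- \<i>/4 * Q \<i> t + (- (1/4) * Q (-1) t + \<i>/4 * Q (-\<i>) t)))"
    by (rule polarization_conv[OF smooth_continuous[OF sm(1)] smooth_continuous[OF sm(2)] Q_def])
  have "h (conv_on a b f g) = cnj (1/4) * h (Q 1) + (cnj (- \<i>/4) * h (Q \<i>) + (cnj (- (1/4)) * h (Q (-1)) + cnj (\<i>/4) * h (Q (-\<i>))))"
    unfolding eq by (simp only: h_add h_cmult test_space_add test_space_cmult QT)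
  then have "cmod (h (conv_on a b f g)) \<le> cmod (h (Q 1)) / 4 + (cmod (h (Q \<i>)) / 4 + (cmod (h (Q (-1))) / 4 + cmod (h (Q (-\<i>))) / 4))"
    by (simp only:) (intro norm_triangle_le add_mono, auto simp: norm_mult norm_divide)
  also have "\<dots> \<le> 4 * C * (b - a)"
    using Qb[of 1] Qb[of \<i>] Qb[of "-1"] Qb[of "-\<i>"] by (simp add: algebra_simps)
  finally show ?thesis .
qed

text \<open>The factors are normalized before polarizing in order to obtain the product
  \<open>A * B\<close>. Polarizing directly would give \<open>(A + B)^2\<close>, which does not
  scale correctly when one factor carries a derivative.\<close>

lemma conv_bound:
  assumes sm: "smooth f" "smooth g" and ab: "0 < a" "a \<le> b"
    and z: "\<And>x. x \<notin> {a..b} \<Longrightarrow> f x = 0" "\<And>x. x \<notin> {a..b} \<Longrightarrow> g x = 0"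
    and le: "\<And>x. cmod (f x) \<le> A" "\<And>x. cmod (g x) \<le> B" and AB: "A > 0" "B > 0"
  shows "cmod (h (conv_on a b f g)) \<le> 4 * C * (b - a) * (A * B)"
proof -
  let ?f = "\<lambda>x. of_real (1 / A) * f x" and ?g = "\<lambda>x. of_real (1 / B) * g x"
  have s: "smooth ?f" "smooth ?g" by (intro smooth_mult smooth_const sm)+
  have T: "conv_on a b ?f ?g \<in> test_space {0<..}"
    by (rule conv_on_test_space[OF smooth_continuous[OF s(1)] s(2), where c = a and d = b and c' = a and d' = b])
      (use z ab in auto)
  have "conv_on a b f g t = of_real (A * B) * conv_on a b ?f ?g t" for t
    using AB unfolding conv_on_def by (simp flip: integral_mult_right add: field_simps)
  then have "h (conv_on a b f g) = cnj (of_real (A * B)) * h (conv_on a b ?f ?g)"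
    using h_cmult[OF T, of "of_real (A * B)"] by presburger
  moreover have "cmod (h (conv_on a b ?f ?g)) \<le> 4 * C * (b - a)"
    by (rule conv_bound_1[OF s ab]) (use z le AB in \<open>auto simp: norm_mult norm_divide\<close>)
  ultimately show ?thesis
    using AB mult_left_mono[of "cmod (h (conv_on a b ?f ?g))" "4 * C * (b - a)" "A * B"]
    by (simp add: norm_mult mult.commute)
qed

end

section \<open>A scale-invariant local estimate\<close>

context hankel_form
begin

text \<open>Both factors of each convolution live in \<open>{a/2..4*a}\<close>, whose length
  \<open>7 * a / 2\<close> cancels against \<open>M / a\<close> in the first and
  \<open>D / a\<close> in the second; \<open>14\<close> is \<open>4 * 7/2\<close>. Positivity of
  \<open>M\<close> allows the normalization in \<open>conv_bound\<close>.\<close>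

lemma local_bound_pos:
  assumes D: "\<And>a b t. b > 0 \<Longrightarrow> cmod (nderiv 1 (dstep a b) t) \<le> D / b" "D > 0"
    and F: "F \<in> test_space {0<..}" and a: "a > 0" and Fz: "\<And>x. x \<notin> {a..4 * a} \<Longrightarrow> F x = 0"
    and M: "M > 0" "\<And>x. cmod (F x) \<le> M" "\<And>x. cmod (nderiv 1 F x) \<le> M / a"
  shows "cmod (h F) \<le> 14 * C * (1 + D) * M"
proof -
  let ?T = "test_space {0<..}"
  let ?\<kappa> = "nderiv 1 (dstep a a)" and ?f = "\<lambda>x. F (x + a/2)"
  define \<theta> where "\<theta> \<delta> = (\<lambda>s. dstep (a/2) \<delta> s * (1 - dstep a a s))" for \<delta>
  define E where "E \<delta> = (\<lambda>t. (conv_on (a/2) (2*a) (\<theta> \<delta>) (nderiv 1 ?f) t + conv_on (a/2) (2*a) ?\<kappa> ?f t) - F t)" for \<delta>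
  note Fs = test_space_smooth[OF F]
  have fs: "smooth ?f" by (rule smooth_shift[OF Fs])
  have f's: "smooth (nderiv 1 ?f)" by (rule smooth_nderiv[OF fs])
  have ks: "smooth ?\<kappa>" by (intro smooth_nderiv smooth_dstep)
  have fz: "?f x = 0" if "x \<notin> {a/2..7*a/2}" for x
    using that by (intro Fz) auto
  have f'z: "nderiv 1 ?f x = 0" if "x \<notin> {a/2..7*a/2}" for x
    by (rule nderiv_zero_outside[OF fz that])
  \<comment> \<open>The step itself does not vanish to the right of \<open>2*a\<close>, but it is
    locally constant on both sides.\<close>
  have kz: "?\<kappa> x = 0" if "x \<notin> {a..2*a}" for x
  proof -
    have "(dstep a a has_vector_derivative 0) (at x)"
    proof (cases "x < a")
      case True
      show ?thesis
        by (rule has_vector_derivative_transform_within_open[where f = "\<lambda>x. 0" and S = "{..<a}"])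
          (use True a in \<open>auto simp: dstep_0\<close>)
    next
      case False
      show ?thesis
        by (rule has_vector_derivative_transform_within_open[where f = "\<lambda>x. 1" and S = "{2*a<..}"])
          (use False that a in \<open>auto simp: dstep_1\<close>)
    qed
    then show ?thesis by (simp add: nderiv_Suc vector_derivative_at)
  qed
  have ts: "smooth (\<theta> \<delta>)" for \<delta>
    unfolding \<theta>_def by (intro smooth_mult smooth_diff smooth_const smooth_dstep)
  have tz: "\<theta> \<delta> x = 0" if "\<delta> > 0" "x \<notin> {a/2..2*a}" for \<delta> x
    using that a by (cases "x < a/2") (auto simp: \<theta>_def dstep_0 dstep_1)
  have tb: "cmod (\<theta> \<delta> x) \<le> 1" for \<delta> x
    unfolding \<theta>_def norm_mult using mult_mono[OF norm_dstep(1) norm_dstep(2)] by simp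
  have cvT1: "conv_on (a/2) (2*a) (\<theta> \<delta>) (nderiv 1 ?f) \<in> ?T" if "\<delta> > 0" for \<delta>
    by (rule conv_on_test_space[where c = "a/2" and d = "2*a" and c' = "a/2" and d' = "7*a/2"])
      (use a smooth_continuous[OF ts] f's tz[OF that] f'z in auto)
  have cvT2: "conv_on (a/2) (2*a) ?\<kappa> ?f \<in> ?T"
    by (rule conv_on_test_space[where c = a and d = "2*a" and c' = "a/2" and d' = "7*a/2"])
      (use a smooth_continuous[OF ks] fs kz fz in auto)
  have ET: "E \<delta> \<in> ?T" if "\<delta> > 0" for \<delta>
    unfolding E_def by (intro test_space_diff test_space_add cvT1 cvT2 F that)
  have Ez: "E \<delta> x = 0" if d: "\<delta> > 0" and x: "x \<notin> {a..6*a}" for \<delta> x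
  proof -
    have "conv_on (a/2) (2*a) (\<theta> \<delta>) (nderiv 1 ?f) x = 0"
      by (rule conv_on_zero_outside[where c = "a/2" and d = "2*a" and c' = "a/2" and d' = "7*a/2"])
        (use x a tz[OF d] f'z in auto)
    moreover have "conv_on (a/2) (2*a) ?\<kappa> ?f x = 0"
      by (rule conv_on_zero_outside[where c = a and d = "2*a" and c' = "a/2" and d' = "7*a/2"])
        (use x a kz fz in auto)
    moreover have "F x = 0" by (rule Fz) (use x a in auto)
    ultimately show ?thesis by (simp add: E_def)
  qed
  \<comment> \<open>Since derivatives fall on the second factor, the \<open>n\<close>-th derivative
    of the remainder is the remainder formed with \<open>nderiv n ?f\<close>. Hence
    \<open>cutoff_identity\<close> bounds every derivative by a multiple of \<delta>.\<close>
  have En: "nderiv n (E \<delta>) t = conv_on (a/2) (2*a) (\<theta> \<delta>) (nderiv 1 (nderiv n ?f)) t + conv_on (a/2) (2*a) ?\<kappa> (nderiv n ?f) t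
      - nderiv n ?f (t - a/2)" for n \<delta> t
  proof -
    have s: "smooth (conv_on (a/2) (2*a) (\<theta> \<delta>) (nderiv 1 ?f))" "smooth (conv_on (a/2) (2*a) ?\<kappa> ?f)"
      by (rule smooth_conv_on[OF smooth_continuous[OF ts] f's]) (rule smooth_conv_on[OF smooth_continuous[OF ks] fs])
    have "nderiv n (E \<delta>) t = conv_on (a/2) (2*a) (\<theta> \<delta>) (nderiv n (nderiv 1 ?f)) t
        + conv_on (a/2) (2*a) ?\<kappa> (nderiv n ?f) t - nderiv n F t"
      unfolding E_def nderiv_diff[OF smooth_add[OF s] Fs] nderiv_add[OF s]
        nderiv_conv_on[OF smooth_continuous[OF ts] f's] nderiv_conv_on[OF smooth_continuous[OF ks] fs] ..
    moreover have "nderiv n (nderiv 1 ?f) = nderiv 1 (nderiv n ?f)"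
      by (simp only: nderiv_nderiv[OF fs] add.commute)
    moreover have "nderiv n ?f (t - a/2) = nderiv n F t"
      by (simp add: nderiv_shift[OF Fs])
    ultimately show ?thesis by simp
  qed
  have "\<forall>n. \<exists>B. \<forall>x. cmod (nderiv 1 (nderiv n ?f) x) \<le> B"
  proof
    fix n
    have "?f \<in> ?T" by (rule test_spaceI[where \<alpha> = "a/2" and \<beta> = "7*a/2"]) (use a fs fz in auto)
    from norm_nderiv_le_SUP[OF this, of "1 + n"] show "\<exists>B. \<forall>x. cmod (nderiv 1 (nderiv n ?f) x) \<le> B"
      unfolding nderiv_nderiv[OF fs] by blast
  qed
  then obtain B where B: "\<And>n x. cmod (nderiv 1 (nderiv n ?f) x) \<le> B n" by metis
  have Eb: "cmod (nderiv n (E \<delta>) t) \<le> B n * \<delta>" if "\<delta> > 0" "\<delta> \<le> a/2" for n \<delta> t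
    unfolding En \<theta>_def by (rule cutoff_identity[OF smooth_nderiv[OF fs] a that B])
  \<comment> \<open>All \<open>E \<delta>\<close> are supported in one compact interval, so a single
    constant and a single order \<open>N\<close> serve every \<delta>.\<close>
  obtain K N where K: "K \<ge> 0" "\<And>f. f \<in> ?T \<Longrightarrow> supp f \<subseteq> {a..6*a} \<Longrightarrow>
      cmod (h f) \<le> K * (\<Sum>n\<le>N. SUP x. cmod (nderiv n f x))"
    by (rule antidual_test_bound[OF h, of "{a..6*a}"]) (use a in auto)
  define B' where "B' = K * (\<Sum>n\<le>N. B n)"
  have hE: "cmod (h (E \<delta>)) \<le> B' * \<delta>" if "\<delta> > 0" "\<delta> \<le> a/2" for \<delta>
  proof -
    have "cmod (h (E \<delta>)) \<le> K * (\<Sum>n\<le>N. SUP x. cmod (nderiv n (E \<delta>) x))"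
      by (intro K(2) ET supp_subset Ez that) auto
    also have "\<dots> \<le> K * (\<Sum>n\<le>N. B n * \<delta>)"
      by (intro mult_left_mono K(1) sum_mono cSUP_least Eb that) auto
    finally show ?thesis by (simp add: B'_def sum_distrib_right mult.assoc)
  qed
  have b1: "cmod (h (conv_on (a/2) (2*a) (\<theta> \<delta>) (nderiv 1 ?f))) \<le> 14 * C * M" if "\<delta> > 0" for \<delta>
  proof -
    have "conv_on (a/2) (2*a) (\<theta> \<delta>) (nderiv 1 ?f) = conv_on (a/2) (4*a) (\<theta> \<delta>) (nderiv 1 ?f)"
      by (rule conv_on_superset[OF smooth_continuous[OF ts] smooth_continuous[OF f's] tz[OF that]]) (use a in auto)
    moreover have "cmod (h (conv_on (a/2) (4*a) (\<theta> \<delta>) (nderiv 1 ?f))) \<le> 4 * C * (4*a - a/2) * (1 * (M / a))"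
      by (rule conv_bound[OF ts f's _ _ _ _ tb])
        (use a M tz[OF that] f'z M(3)[of "_ + a/2"] in \<open>auto simp: nderiv_shift[OF Fs]\<close>)
    ultimately show ?thesis using a by (simp add: field_simps)
  qed
  have b2: "cmod (h (conv_on (a/2) (2*a) ?\<kappa> ?f)) \<le> 14 * C * D * M"
  proof -
    have "conv_on (a/2) (2*a) ?\<kappa> ?f = conv_on (a/2) (4*a) ?\<kappa> ?f"
      by (rule conv_on_superset[OF smooth_continuous[OF ks] smooth_continuous[OF fs]]) (use a kz in auto)
    moreover have "cmod (h (conv_on (a/2) (4*a) ?\<kappa> ?f)) \<le> 4 * C * (4*a - a/2) * (D / a * M)"
      by (rule conv_bound[OF ks fs _ _ _ _ D(1)]) (use a M D(2) kz fz in auto)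
    ultimately show ?thesis using a by (simp add: field_simps)
  qed
  have main: "cmod (h F) \<le> 14 * C * (1 + D) * M + B' * \<delta>" if d: "\<delta> > 0" "\<delta> \<le> a/2" for \<delta>
  proof -
    have "h (E \<delta>) = (h (conv_on (a/2) (2*a) (\<theta> \<delta>) (nderiv 1 ?f)) + h (conv_on (a/2) (2*a) ?\<kappa> ?f)) - h F"
      unfolding E_def by (simp only: h_diff h_add test_space_add cvT1 cvT2 F d)
    then have "h F = (h (conv_on (a/2) (2*a) (\<theta> \<delta>) (nderiv 1 ?f)) + h (conv_on (a/2) (2*a) ?\<kappa> ?f)) - h (E \<delta>)"
      by simp
    then have "cmod (h F) \<le> cmod (h (conv_on (a/2) (2*a) (\<theta> \<delta>) (nderiv 1 ?f))) + cmod (h (conv_on (a/2) (2*a) ?\<kappa> ?f)) + cmod (h (E \<delta>))"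
      using norm_triangle_ineq norm_triangle_ineq4 by (smt (verit))
    then show ?thesis using b1[OF d(1)] b2 hE[OF d] by (simp add: algebra_simps)
  qed
  have "((\<lambda>\<delta>. 14 * C * (1 + D) * M + B' * \<delta>) \<longlongrightarrow> 14 * C * (1 + D) * M + B' * 0) (at_right 0)"
    by (intro tendsto_intros)
  then have "((\<lambda>\<delta>. 14 * C * (1 + D) * M + B' * \<delta>) \<longlongrightarrow> 14 * C * (1 + D) * M) (at_right 0)" by simp
  then show ?thesis
  proof (rule tendsto_lowerbound)
    show "\<forall>\<^sub>F \<delta> in at_right 0. cmod (h F) \<le> 14 * C * (1 + D) * M + B' * \<delta>"
      using eventually_at_right_less[of 0] eventually_at_right_real[of 0 "a/2"] a
      by (auto elim!: eventually_mono intro!: main)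
  qed simp
qed

text \<open>The case \<open>M = 0\<close> is reached by applying \<open>local_bound_pos\<close> with
  \<open>M + e\<close> and letting \<open>e\<close> tend to 0.\<close>

lemma local_bound:
  obtains K where "K \<ge> 0"
    "\<And>a M F. F \<in> test_space {0<..} \<Longrightarrow> a > 0 \<Longrightarrow> (\<And>x. x \<notin> {a..4 * a} \<Longrightarrow> F x = 0) \<Longrightarrow> M \<ge> 0 \<Longrightarrow>
      (\<And>x. cmod (F x) \<le> M) \<Longrightarrow> (\<And>x. cmod (nderiv 1 F x) \<le> M / a) \<Longrightarrow> cmod (h F) \<le> K * M"
proof -
  obtain D where D: "D > 0" "\<And>a b t. b > 0 \<Longrightarrow> cmod (nderiv 1 (dstep a b) t) \<le> D / b"
    by (rule dstep_deriv_bound) blast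
  let ?K = "14 * C * (1 + D)"
  show ?thesis
  proof (rule that)
    show K0: "?K \<ge> 0" using C D(1) by simp
    fix a M F
    assume F: "F \<in> test_space {0<..}" "a > 0" "\<And>x. x \<notin> {a..4 * a} \<Longrightarrow> F x = 0" "M \<ge> 0"
      "\<And>x. cmod (F x) \<le> M" "\<And>x. cmod (nderiv 1 F x) \<le> M / a"
    have b: "cmod (h F) \<le> ?K * (M + e)" if "e > 0" for e
    proof (rule local_bound_pos[OF D(2,1) F(1-3)])
      fix x
      show "M + e > 0" "cmod (F x) \<le> M + e" using that F(4) F(5)[of x] by linarith+
      have "M / a \<le> (M + e) / a" using F(2) that by (simp add: divide_right_mono)
      then show "cmod (nderiv 1 F x) \<le> (M + e) / a" using F(6)[of x] by linarith
    qed
    have "((\<lambda>e. ?K * (M + e)) \<longlongrightarrow> ?K * (M + 0)) (at_right 0)" by (intro tendsto_intros)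
    then have "((\<lambda>e. ?K * (M + e)) \<longlongrightarrow> ?K * M) (at_right 0)" by simp
    then show "cmod (h F) \<le> ?K * M"
    proof (rule tendsto_lowerbound)
      show "\<forall>\<^sub>F e in at_right 0. cmod (h F) \<le> ?K * (M + e)"
        using eventually_at_right_less[of 0] by (rule eventually_mono) (rule b)
    qed simp
  qed
qed

end

section \<open>A dyadic partition of unity on the half-line\<close>

definition dyadic :: "int \<Rightarrow> real" where "dyadic k = 2 powr of_int k"

lemma dyadic_pos: "dyadic k > 0" by (simp add: dyadic_def)

lemma dyadic_Suc: "dyadic (k + 1) = 2 * dyadic k"
  by (simp add: dyadic_def powr_add)

text \<open>The second step begins to rise where the first reaches 1, which confines the bump to
  \<open>{dyadic k..4 * dyadic k}\<close>; sums over consecutive \<open>k\<close> telescope.\<close>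

definition bump :: "int \<Rightarrow> real \<Rightarrow> complex" where
  "bump k t = dstep (dyadic k) (dyadic k) t - dstep (dyadic (k + 1)) (dyadic (k + 1)) t"

lemma smooth_bump: "smooth (bump k)"
  unfolding bump_def[abs_def] by (intro smooth_diff smooth_dstep)

lemma bump_zero: "t \<notin> {dyadic k..4 * dyadic k} \<Longrightarrow> bump k t = 0"
  using dyadic_pos[of k] by (cases "t < dyadic k") (auto simp: bump_def dyadic_Suc dstep_0 dstep_1)

lemma norm_bump: "cmod (bump k t) \<le> 2"
  unfolding bump_def using norm_triangle_ineq4 norm_dstep(1) by (smt (verit))

text \<open>\<open>ln t\<close> lies between \<open>k * ln 2\<close> and
  \<open>(k + 2) * ln 2\<close>, and \<open>ln 2\<close> is at least 1/2. For \<open>k = -1\<close>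
  these bounds have opposite signs, but there the left side is at most 1.\<close>

lemma dyadic_ln_bound:
  assumes "t \<in> {dyadic k..4 * dyadic k}"
  shows "(1 + \<bar>of_int k\<bar>) / 4 \<le> 1 + \<bar>ln t\<bar>"
proof -
  have t: "t > 0" using assms dyadic_pos[of k] by auto
  have l: "ln (dyadic k) = of_int k * ln 2" by (simp add: dyadic_def)
  have l4: "ln (4 * dyadic k) = (of_int k + 2) * ln 2"
    using l dyadic_pos[of k] ln_mult_pos[of 4 "dyadic k"] ln_powr[of 2 2] by (simp add: algebra_simps)
  have l1: "of_int k * ln 2 \<le> ln t"
    using assms t dyadic_pos[of k] ln_le_cancel_iff[of "dyadic k" t] l by simp
  have l2: "ln t \<le> (of_int k + 2) * ln 2"
    using assms t dyadic_pos[of k] ln_le_cancel_iff[of t "4 * dyadic k"] l4 by simp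
  have l3: "1/2 \<le> ln (2::real)" using ln2_ge_two_thirds by simp
  consider "k \<ge> 0" | "k = -1" | "k \<le> -2" by linarith
  then show ?thesis
  proof cases
    case 1
    then have "of_int k * (1/2) \<le> of_int k * ln (2::real)" by (intro mult_left_mono l3) auto
    then show ?thesis using l1 1 by simp
  next
    case 3
    then have "(of_int k + 2) * ln (2::real) \<le> (of_int k + 2) * (1/2)"
      by (intro mult_left_mono_neg l3) (simp flip: of_int_add)
    then show ?thesis using l2 3 by simp
  qed auto
qed

text \<open>The indices \<open>n\<close> and \<open>- n - 1\<close> together run through all
  integers, so an ordinary series can be used; both have absolute value at least \<open>n\<close>,
  which provides the decay.\<close>

definition pair_bump :: "nat \<Rightarrow> real \<Rightarrow> complex" where
  "pair_bump n t = bump (int n) t + bump (- int n - 1) t"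

lemma sum_pair_bump:
  "(\<Sum>n<N. pair_bump n t) =
    dstep (dyadic (- int N)) (dyadic (- int N)) t - dstep (dyadic (int N)) (dyadic (int N)) t"
proof (induction N)
  case (Suc N)
  have e: "int (Suc N) = int N + 1" "- (int N + 1) = - int N - 1" "- int N - 1 + 1 = - int N" by auto
  show ?case
    unfolding sum.lessThan_Suc Suc.IH unfolding pair_bump_def bump_def e by simp
qed simp

text \<open>The hypotheses are \<open>2 * dyadic (- int N) \<le> t\<close> and
  \<open>t \<le> dyadic (int N)\<close> in logarithmic form: the lower step of the telescoped sum is
  already 1 and the upper one still 0.\<close>

lemma sum_pair_bump_eq_1:
  assumes "t > 0" "ln t / ln 2 \<le> real N" "1 - real N \<le> ln t / ln 2"
  shows "(\<Sum>n<N. pair_bump n t) = 1"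
proof -
  have e: "t = 2 powr (ln t / ln 2)" using assms(1) by (simp add: powr_def)
  have "t \<le> dyadic (int N)"
    unfolding dyadic_def by (subst e) (use assms(2) in \<open>auto intro!: powr_mono\<close>)
  moreover have "2 * dyadic (- int N) \<le> t"
    unfolding dyadic_Suc[symmetric] unfolding dyadic_def
    by (subst e) (use assms(3) in \<open>auto intro!: powr_mono\<close>)
  ultimately show ?thesis unfolding sum_pair_bump by (simp add: dstep_0 dstep_1 dyadic_pos)
qed

context hankel_form
begin

text \<open>\<open>F\<close> is smooth on the half-line only, as \<Omega>(ln t) is. The product
  vanishes to the left of \<open>dyadic k\<close>, and the two overlapping open sets cover the
  line.\<close>

lemma bump_mult_test_space:
  assumes "\<And>n. diffn n {0<..} F"
  shows "(\<lambda>t. bump k t * F t) \<in> test_space {0<..}"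
proof (rule test_spaceI)
  have "diffn n UNIV (\<lambda>t. bump k t * F t)" for n
  proof -
    have "diffn n {0<..} (\<lambda>t. bump k t * F t)"
      using smooth_bump by (intro diffn_mult assms) (auto simp: smooth_iff_diffn intro: diffn_subset)
    moreover have "diffn n {..<dyadic k} (\<lambda>t. bump k t * F t)"
      by (rule diffn_cong[OF _ _ diffn_const[of _ _ 0]]) (auto simp: bump_zero)
    ultimately have "diffn n ({0<..} \<union> {..<dyadic k}) (\<lambda>t. bump k t * F t)"
      by (intro diffn_Un) auto
    moreover have "{0<..} \<union> {..<dyadic k} = UNIV" using dyadic_pos[of k] by auto
    ultimately show ?thesis by simp
  qed
  then show "smooth (\<lambda>t. bump k t * F t)" by (simp add: smooth_iff_diffn)
  show "{dyadic k..4 * dyadic k} \<subseteq> {0<..}" using dyadic_pos[of k] by auto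
qed (simp add: bump_zero)

text \<open>By the product rule the derivative is at most \<open>2 * M / a + 2 * D * M / a\<close>
  with \<open>a = dyadic k\<close>, whence \<open>2 * D + 2\<close>. The derivative of
  \<open>F\<close> enters through \<open>t * F' t\<close>, the dilation-invariant quantity.\<close>

lemma bump_bound:
  obtains K where "K \<ge> 0"
    "\<And>k F F' M. (\<And>n. diffn n {0<..} F) \<Longrightarrow> (\<And>t. t > 0 \<Longrightarrow> (F has_vector_derivative F' t) (at t)) \<Longrightarrow>
      (\<And>t. t \<in> {dyadic k..4 * dyadic k} \<Longrightarrow> cmod (F t) \<le> M) \<Longrightarrow>
      (\<And>t. t \<in> {dyadic k..4 * dyadic k} \<Longrightarrow> t * cmod (F' t) \<le> M) \<Longrightarrow>
      cmod (h (\<lambda>t. bump k t * F t)) \<le> K * M"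
proof -
  obtain D where D: "D > 0" "\<And>a b t. b > 0 \<Longrightarrow> cmod (nderiv 1 (dstep a b) t) \<le> D / b"
    by (rule dstep_deriv_bound) blast
  obtain K where K: "K \<ge> 0"
    "\<And>a M F. F \<in> test_space {0<..} \<Longrightarrow> a > 0 \<Longrightarrow> (\<And>x. x \<notin> {a..4 * a} \<Longrightarrow> F x = 0) \<Longrightarrow> M \<ge> 0 \<Longrightarrow>
      (\<And>x. cmod (F x) \<le> M) \<Longrightarrow> (\<And>x. cmod (nderiv 1 F x) \<le> M / a) \<Longrightarrow> cmod (h F) \<le> K * M"
    by (rule local_bound) blast
  show ?thesis
  proof (rule that[of "K * (2 * D + 2)"])
    show "K * (2 * D + 2) \<ge> 0" using K(1) D(1) by simp
    fix k F F' M
    assume F: "\<And>n. diffn n {0<..} F" and F': "\<And>t. t > 0 \<Longrightarrow> (F has_vector_derivative F' t) (at t)"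
      and M1: "\<And>t. t \<in> {dyadic k..4 * dyadic k} \<Longrightarrow> cmod (F t) \<le> M"
      and M2: "\<And>t. t \<in> {dyadic k..4 * dyadic k} \<Longrightarrow> t * cmod (F' t) \<le> M"
    let ?a = "dyadic k"
    let ?G = "\<lambda>t. bump k t * F t"
    note a = dyadic_pos[of k]
    have M0: "M \<ge> 0" using M1[of ?a] a by (intro order_trans[OF norm_ge_zero]) auto
    have nb: "cmod (nderiv 1 (bump k) t) \<le> 2 * D / ?a" for t
    proof -
      have "cmod (nderiv 1 (bump k) t) \<le> D / ?a + D / dyadic (k + 1)"
        unfolding bump_def[abs_def]
        by (simp only: nderiv_diff smooth_dstep)
          (intro order_trans[OF norm_triangle_ineq4] add_mono D(2) dyadic_pos)
      also have "\<dots> \<le> 2 * D / ?a" unfolding dyadic_Suc using a D(1) by (simp add: field_simps)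
      finally show ?thesis .
    qed
    have z: "?G x = 0" if "x \<notin> {?a..4 * ?a}" for x using that by (simp add: bump_zero)
    have "cmod (h ?G) \<le> K * ((2 * D + 2) * M)"
    proof (rule K(2)[OF bump_mult_test_space[OF F] a z])
      show "(2 * D + 2) * M \<ge> 0" using D(1) M0 by simp
      fix x
      show "cmod (?G x) \<le> (2 * D + 2) * M"
      proof (cases "x \<in> {?a..4 * ?a}")
        case True
        then have "cmod (?G x) \<le> 2 * M"
          unfolding norm_mult by (intro mult_mono norm_bump M1) auto
        also have "\<dots> \<le> (2 * D + 2) * M" using D(1) M0 by (intro mult_right_mono) auto
        finally show ?thesis .
      next
        case False
        show ?thesis by (subst z[OF False]) (use D(1) M0 in simp)
      qed
      show "cmod (nderiv 1 ?G x) \<le> (2 * D + 2) * M / ?a"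
      proof (cases "x \<in> {?a..4 * ?a}")
        case True
        then have x: "x > 0" "?a \<le> x" using a by auto
        have "(?G has_vector_derivative bump k x * F' x + nderiv 1 (bump k) x * F x) (at x)"
          using smooth_nderiv_deriv[OF smooth_bump, of 0 k x] F'[OF x(1)]
          by (intro has_vector_derivative_mult) auto
        then have "nderiv 1 ?G x = bump k x * F' x + nderiv 1 (bump k) x * F x"
          by (simp add: nderiv_Suc vector_derivative_at)
        moreover have "cmod (F' x) \<le> M / ?a"
        proof -
          have "?a * cmod (F' x) \<le> x * cmod (F' x)" using x(2) by (intro mult_right_mono) auto
          then show ?thesis using M2[OF True] a by (simp add: field_simps)
        qed
        ultimately have "cmod (nderiv 1 ?G x) \<le> 2 * (M / ?a) + 2 * D / ?a * M"
          by (simp only:) (intro order_trans[OF norm_triangle_ineq] add_mono order_trans[OF eq_refl[OF norm_mult]]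
            mult_mono norm_bump nb M1[OF True], use D(1) a in auto)
        also have "\<dots> = (2 * D + 2) * M / ?a" by (simp add: add_divide_distrib algebra_simps)
        finally show ?thesis .
      next
        case False
        then show ?thesis using nderiv_zero_outside[OF z False, where n = 1] D(1) M0 a by simp
      qed
    qed
    then show "cmod (h ?G) \<le> K * (2 * D + 2) * M" by (simp add: mult.assoc)
  qed
qed

lemma pair_bump_mult_test_space:
  assumes "\<And>n. diffn n {0<..} F"
  shows "(\<lambda>t. pair_bump m t * F t) \<in> test_space {0<..}"
  using test_space_add[OF bump_mult_test_space[OF assms, of "int m"] bump_mult_test_space[OF assms, of "- int m - 1"]]
  by (simp add: pair_bump_def distrib_right)

text \<open>\<open>dyadic_ln_bound\<close> loses a factor 4, hence 16 after squaring, and each pair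
  consists of two bumps: \<open>32 * K\<close>.\<close>

lemma pair_bump_bound:
  obtains K where "K \<ge> 0"
    "\<And>m F F' S. (\<And>n. diffn n {0<..} F) \<Longrightarrow> (\<And>t. t > 0 \<Longrightarrow> (F has_vector_derivative F' t) (at t)) \<Longrightarrow>
      (\<And>t. t > 0 \<Longrightarrow> (1 + \<bar>ln t\<bar>)\<^sup>2 * cmod (F t) \<le> S) \<Longrightarrow>
      (\<And>t. t > 0 \<Longrightarrow> (1 + \<bar>ln t\<bar>)\<^sup>2 * (t * cmod (F' t)) \<le> S) \<Longrightarrow>
      cmod (h (\<lambda>t. pair_bump m t * F t)) \<le> K * S * (1 / (1 + real m)\<^sup>2)"
proof -
  obtain K where K: "K \<ge> 0"
    "\<And>k F F' M. (\<And>n. diffn n {0<..} F) \<Longrightarrow> (\<And>t. t > 0 \<Longrightarrow> (F has_vector_derivative F' t) (at t)) \<Longrightarrow>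
      (\<And>t. t \<in> {dyadic k..4 * dyadic k} \<Longrightarrow> cmod (F t) \<le> M) \<Longrightarrow>
      (\<And>t. t \<in> {dyadic k..4 * dyadic k} \<Longrightarrow> t * cmod (F' t) \<le> M) \<Longrightarrow>
      cmod (h (\<lambda>t. bump k t * F t)) \<le> K * M"
    by (rule bump_bound) blast
  show ?thesis
  proof (rule that[of "32 * K"])
    fix m F F' S
    assume F: "\<And>n. diffn n {0<..} F" and F': "\<And>t. t > 0 \<Longrightarrow> (F has_vector_derivative F' t) (at t)"
      and S1: "\<And>t. t > 0 \<Longrightarrow> (1 + \<bar>ln t\<bar>)\<^sup>2 * cmod (F t) \<le> S"
      and S2: "\<And>t. t > 0 \<Longrightarrow> (1 + \<bar>ln t\<bar>)\<^sup>2 * (t * cmod (F' t)) \<le> S"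
    let ?T = "test_space {0<..}"
    have le: "y \<le> 16 * S / (1 + real m)\<^sup>2"
      if k: "\<bar>of_int k\<bar> \<ge> real m" and t: "t \<in> {dyadic k..4 * dyadic k}"
        and y: "(1 + \<bar>ln t\<bar>)\<^sup>2 * y \<le> S" "y \<ge> 0" for k t y
    proof -
      have "(1 + real m) / 4 \<le> 1 + \<bar>ln t\<bar>" using dyadic_ln_bound[OF t] k by (simp add: field_simps)
      then have "((1 + real m) / 4)\<^sup>2 \<le> (1 + \<bar>ln t\<bar>)\<^sup>2" by (intro power_mono) auto
      then have "((1 + real m) / 4)\<^sup>2 * y \<le> S" using y by (meson mult_right_mono order_trans)
      then show ?thesis by (simp add: power_divide field_simps)
    qed
    have b: "cmod (h (\<lambda>t. bump k t * F t)) \<le> K * (16 * S / (1 + real m)\<^sup>2)"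
      if k: "\<bar>of_int k\<bar> \<ge> real m" for k
    proof (rule K(2)[OF F F'])
      fix t assume t: "t \<in> {dyadic k..4 * dyadic k}"
      then have t0: "t > 0" using dyadic_pos[of k] by auto
      show "cmod (F t) \<le> 16 * S / (1 + real m)\<^sup>2" by (rule le[OF k t S1[OF t0]]) simp
      show "t * cmod (F' t) \<le> 16 * S / (1 + real m)\<^sup>2" by (rule le[OF k t S2[OF t0]]) (use t0 in simp)
    qed
    have "h (\<lambda>t. pair_bump m t * F t) = h (\<lambda>t. bump (int m) t * F t) + h (\<lambda>t. bump (- int m - 1) t * F t)"
      unfolding pair_bump_def distrib_right by (intro h_add bump_mult_test_space F)
    then have "cmod (h (\<lambda>t. pair_bump m t * F t)) \<le> K * (16 * S / (1 + real m)\<^sup>2) + K * (16 * S / (1 + real m)\<^sup>2)"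
      by (simp only:) (intro norm_triangle_le add_mono b, auto)
    then show "cmod (h (\<lambda>t. pair_bump m t * F t)) \<le> 32 * K * S * (1 / (1 + real m)\<^sup>2)" by simp
  qed (use K(1) in simp)
qed

end

section \<open>Summation over dyadic scales\<close>

context hankel_form
begin

text \<open>On the compact support of \<open>F\<close> the partial sums of the partition are
  eventually identically 1, so finite additivity of \<open>h\<close> suffices.\<close>

lemma eventually_pair_bump_sum:
  assumes F: "F \<in> test_space {0<..}"
  shows "\<forall>\<^sub>F N in sequentially. (\<Sum>m<N. h (\<lambda>t. pair_bump m t * F t)) = h F"
proof -
  obtain \<alpha> \<beta> where ab: "0 < \<alpha>" "\<alpha> \<le> \<beta>" "\<And>x. x \<notin> {\<alpha>..\<beta>} \<Longrightarrow> F x = 0"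
    by (rule test_space_pos_bounds[OF F]) blast
  obtain N0 :: nat where N0: "\<bar>ln \<alpha> / ln 2\<bar> + \<bar>ln \<beta> / ln 2\<bar> + 1 \<le> real N0"
    using real_arch_simple by blast
  have dF: "diffn n {0<..} F" for n
    using test_space_smooth[OF F] diffn_subset[of n UNIV F] by (simp add: smooth_iff_diffn)
  have "(\<Sum>m<N. h (\<lambda>t. pair_bump m t * F t)) = h F" if N: "N \<ge> N0" for N
  proof -
    have "(\<Sum>m<N. pair_bump m t * F t) = F t" for t
    proof (cases "t \<in> {\<alpha>..\<beta>}")
      case True
      then have "ln \<alpha> / ln 2 \<le> ln t / ln 2" "ln t / ln 2 \<le> ln \<beta> / ln 2" "t > 0"
        using ab by (auto intro!: divide_right_mono)
      then have "(\<Sum>m<N. pair_bump m t) = 1"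
        using N0 N by (intro sum_pair_bump_eq_1) linarith+
      then show ?thesis by (simp flip: sum_distrib_right)
    qed (simp add: ab(3))
    then have "h F = h (\<lambda>t. \<Sum>m<N. pair_bump m t * F t)" by simp
    also have "\<dots> = (\<Sum>m<N. h (\<lambda>t. pair_bump m t * F t))"
      by (intro h_sum pair_bump_mult_test_space dF)
    finally show ?thesis ..
  qed
  then show ?thesis unfolding eventually_sequentially by blast
qed

end

lemma summable_pair_weights: "summable (\<lambda>m. 1 / (1 + real m)\<^sup>2)"
  using inverse_power_summable[of 2, where 'a = real] summable_Suc_iff[of "\<lambda>n. inverse (real n ^ 2)"]
  by (simp add: inverse_eq_divide)

context hankel_form
begin

text \<open>For a Schwartz function \<Omega> the function \<Omega>(ln t) is in general no test
  function, but each piece cut out by \<open>pair_bump\<close> is. The values of \<open>ln\<close>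
  at nonpositive arguments are multiplied by zero.\<close>

definition log_extension :: "(real \<Rightarrow> complex) \<Rightarrow> complex" where
  "log_extension \<Omega> = (\<Sum>m. h (\<lambda>t. pair_bump m t * \<Omega> (ln t)))"

lemma weighted_series_bound:
  obtains K where "K \<ge> 0"
    "\<And>F F' S. (\<And>n. diffn n {0<..} F) \<Longrightarrow> (\<And>t. t > 0 \<Longrightarrow> (F has_vector_derivative F' t) (at t)) \<Longrightarrow>
      (\<And>t. t > 0 \<Longrightarrow> (1 + \<bar>ln t\<bar>)\<^sup>2 * cmod (F t) \<le> S) \<Longrightarrow>
      (\<And>t. t > 0 \<Longrightarrow> (1 + \<bar>ln t\<bar>)\<^sup>2 * (t * cmod (F' t)) \<le> S) \<Longrightarrow>
      summable (\<lambda>m. h (\<lambda>t. pair_bump m t * F t)) \<and>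
      cmod (\<Sum>m. h (\<lambda>t. pair_bump m t * F t)) \<le> K * S"
proof -
  obtain K where K: "K \<ge> 0"
    "\<And>m F F' S. (\<And>n. diffn n {0<..} F) \<Longrightarrow> (\<And>t. t > 0 \<Longrightarrow> (F has_vector_derivative F' t) (at t)) \<Longrightarrow>
      (\<And>t. t > 0 \<Longrightarrow> (1 + \<bar>ln t\<bar>)\<^sup>2 * cmod (F t) \<le> S) \<Longrightarrow>
      (\<And>t. t > 0 \<Longrightarrow> (1 + \<bar>ln t\<bar>)\<^sup>2 * (t * cmod (F' t)) \<le> S) \<Longrightarrow>
      cmod (h (\<lambda>t. pair_bump m t * F t)) \<le> K * S * (1 / (1 + real m)\<^sup>2)"
    by (rule pair_bump_bound) blast
  let ?Z = "\<Sum>m. 1 / (1 + real m)\<^sup>2"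
  show ?thesis
  proof (rule that[of "K * ?Z"])
    show "K * ?Z \<ge> 0"
      by (intro mult_nonneg_nonneg K(1) suminf_nonneg summable_pair_weights) auto
    fix F F' S
    assume *: "\<And>n. diffn n {0<..} F" "\<And>t. t > 0 \<Longrightarrow> (F has_vector_derivative F' t) (at t)"
      "\<And>t. t > 0 \<Longrightarrow> (1 + \<bar>ln t\<bar>)\<^sup>2 * cmod (F t) \<le> S"
      "\<And>t. t > 0 \<Longrightarrow> (1 + \<bar>ln t\<bar>)\<^sup>2 * (t * cmod (F' t)) \<le> S"
    have b: "cmod (h (\<lambda>t. pair_bump m t * F t)) \<le> K * S * (1 / (1 + real m)\<^sup>2)" for m
      by (rule K(2)[OF *])
    have s: "summable (\<lambda>m. K * S * (1 / (1 + real m)\<^sup>2))"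
      by (intro summable_mult summable_pair_weights)
    have "summable (\<lambda>m. h (\<lambda>t. pair_bump m t * F t))"
      by (rule summable_comparison_test'[OF s]) (rule b)
    moreover have "cmod (\<Sum>m. h (\<lambda>t. pair_bump m t * F t)) \<le> (\<Sum>m. K * S * (1 / (1 + real m)\<^sup>2))"
      by (rule norm_suminf_le[OF b s])
    ultimately show "summable (\<lambda>m. h (\<lambda>t. pair_bump m t * F t)) \<and>
        cmod (\<Sum>m. h (\<lambda>t. pair_bump m t * F t)) \<le> K * ?Z * S"
      using suminf_mult[OF summable_pair_weights, of "K * S"] by (simp add: mult_ac)
  qed
qed

lemma suminf_pair_bump:
  assumes "F \<in> test_space {0<..}"
  shows "(\<Sum>m. h (\<lambda>t. pair_bump m t * F t)) = h F"
  using tendsto_eventually[OF eventually_pair_bump_sum[OF assms]]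
  by (intro sums_unique[symmetric]) (simp add: sums_def)

lemma test_bound:
  obtains K where "K \<ge> 0"
    "\<And>F S. F \<in> test_space {0<..} \<Longrightarrow> (\<And>t. t > 0 \<Longrightarrow> (1 + \<bar>ln t\<bar>)\<^sup>2 * cmod (F t) \<le> S) \<Longrightarrow>
      (\<And>t. t > 0 \<Longrightarrow> (1 + \<bar>ln t\<bar>)\<^sup>2 * (t * cmod (nderiv 1 F t)) \<le> S) \<Longrightarrow> cmod (h F) \<le> K * S"
proof -
  obtain K where K: "K \<ge> 0"
    "\<And>F F' S. (\<And>n. diffn n {0<..} F) \<Longrightarrow> (\<And>t. t > 0 \<Longrightarrow> (F has_vector_derivative F' t) (at t)) \<Longrightarrow>
      (\<And>t. t > 0 \<Longrightarrow> (1 + \<bar>ln t\<bar>)\<^sup>2 * cmod (F t) \<le> S) \<Longrightarrow>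
      (\<And>t. t > 0 \<Longrightarrow> (1 + \<bar>ln t\<bar>)\<^sup>2 * (t * cmod (F' t)) \<le> S) \<Longrightarrow>
      summable (\<lambda>m. h (\<lambda>t. pair_bump m t * F t)) \<and>
      cmod (\<Sum>m. h (\<lambda>t. pair_bump m t * F t)) \<le> K * S"
    by (rule weighted_series_bound) blast
  show ?thesis
  proof (rule that[OF K(1)])
    fix F S
    assume F: "F \<in> test_space {0<..}"
      and S: "\<And>t. t > 0 \<Longrightarrow> (1 + \<bar>ln t\<bar>)\<^sup>2 * cmod (F t) \<le> S"
        "\<And>t. t > 0 \<Longrightarrow> (1 + \<bar>ln t\<bar>)\<^sup>2 * (t * cmod (nderiv 1 F t)) \<le> S"
    note Fs = test_space_smooth[OF F]
    have "cmod (\<Sum>m. h (\<lambda>t. pair_bump m t * F t)) \<le> K * S"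
    proof (rule conjunct2[OF K(2)])
      show "diffn n {0<..} F" for n
        using Fs diffn_subset[of n UNIV F] by (simp add: smooth_iff_diffn)
      show "(F has_vector_derivative nderiv 1 F t) (at t)" for t
        using smooth_nderiv_deriv[OF Fs, of 0] by simp
    qed (use S in auto)
    then show "cmod (h F) \<le> K * S" by (simp add: suminf_pair_bump[OF F])
  qed
qed

lemma weighted_sup_bound:
  assumes "\<kappa> > 2"
  shows "\<exists>C. \<forall>F\<in>test_space {0<..}.
    cmod (h F) \<le> C * (\<Sum>n\<le>2. SUP t\<in>{0<..}. (1 + \<bar>ln t\<bar>) powr \<kappa> * t ^ n * cmod (nderiv n F t))"
proof -
  obtain K where K: "K \<ge> 0"
    "\<And>F S. F \<in> test_space {0<..} \<Longrightarrow> (\<And>t. t > 0 \<Longrightarrow> (1 + \<bar>ln t\<bar>)\<^sup>2 * cmod (F t) \<le> S) \<Longrightarrow>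
      (\<And>t. t > 0 \<Longrightarrow> (1 + \<bar>ln t\<bar>)\<^sup>2 * (t * cmod (nderiv 1 F t)) \<le> S) \<Longrightarrow> cmod (h F) \<le> K * S"
    by (rule test_bound) blast
  show ?thesis
  proof (rule exI[of _ K], rule ballI)
    fix F :: "real \<Rightarrow> complex" assume F: "F \<in> test_space {0<..}"
    obtain \<alpha> \<beta> where ab: "0 < \<alpha>" "\<alpha> \<le> \<beta>" "\<And>x. x \<notin> {\<alpha>..\<beta>} \<Longrightarrow> F x = 0"
      by (rule test_space_pos_bounds[OF F]) blast
    let ?w = "\<lambda>n t. (1 + \<bar>ln t\<bar>) powr \<kappa> * t ^ n * cmod (nderiv n F t)"
    let ?S = "\<Sum>n\<le>2. SUP t\<in>{0<..}. ?w n t"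
    \<comment> \<open>A real supremum bounds its members only once boundedness is known. The support
      of \<open>F\<close> keeps away from 0, so the weight is continuous on it.\<close>
    have bdd: "bdd_above (?w n ` {0<..})" for n
    proof -
      have "continuous_on {\<alpha>..\<beta>} (?w n)"
        using ab(1) by (intro continuous_intros continuous_nderiv test_space_smooth[OF F]) auto
      then have "bounded (?w n ` {\<alpha>..\<beta>})"
        by (intro compact_imp_bounded compact_continuous_image) auto
      then obtain B where B: "B > 0" "\<And>t. t \<in> {\<alpha>..\<beta>} \<Longrightarrow> \<bar>?w n t\<bar> \<le> B"
        unfolding bounded_pos by auto
      have "?w n t \<le> B" for t
      proof (cases "t \<in> {\<alpha>..\<beta>}")
        case True
        then show ?thesis using B(2)[OF True] by linarith
      next
        case False
        then show ?thesis using B(1) nderiv_zero_outside[where f = F and n = n, OF ab(3) False] by simp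
      qed
      then show ?thesis by (intro bdd_aboveI[of _ B]) auto
    qed
    have nn: "0 \<le> (SUP t\<in>{0<..}. ?w n t)" for n
    proof -
      have "0 \<le> ?w n 1" by simp
      also have "\<dots> \<le> (SUP t\<in>{0<..}. ?w n t)" by (rule cSUP_upper[OF _ bdd]) simp
      finally show ?thesis .
    qed
    have le: "(1 + \<bar>ln t\<bar>)\<^sup>2 * (t ^ n * cmod (nderiv n F t)) \<le> ?S" if t: "t > 0" and n: "n \<le> 2" for t n
    proof -
      have "(1 + \<bar>ln t\<bar>)\<^sup>2 = (1 + \<bar>ln t\<bar>) powr 2" by (simp add: powr_numeral)
      \<comment> \<open>The base is at least 1, so raising the exponent from 2 to \<kappa> only
        enlarges the weight.\<close>
      also have "\<dots> \<le> (1 + \<bar>ln t\<bar>) powr \<kappa>" using assms by (intro powr_mono) auto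
      finally have "(1 + \<bar>ln t\<bar>)\<^sup>2 * (t ^ n * cmod (nderiv n F t)) \<le> ?w n t"
        using t mult_right_mono[of "(1 + \<bar>ln t\<bar>)\<^sup>2" "(1 + \<bar>ln t\<bar>) powr \<kappa>" "t ^ n * cmod (nderiv n F t)"]
        by (simp add: mult.assoc)
      also have "\<dots> \<le> (SUP t\<in>{0<..}. ?w n t)" by (rule cSUP_upper[OF _ bdd]) (use t in simp)
      also have "\<dots> \<le> ?S" by (rule member_le_sum) (use n nn in auto)
      finally show ?thesis .
    qed
    show "cmod (h F) \<le> K * ?S"
      by (rule K(2)[OF F]) (use le[of _ 0] le[of _ 1] in simp_all)
  qed
qed

end

section \<open>Schwartz seminorms and linear operations on Schwartz functions and
  \<open>Z_space\<close>\<close>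

definition schwartz_norm :: "nat \<Rightarrow> nat \<Rightarrow> (real \<Rightarrow> complex) \<Rightarrow> real" where
  "schwartz_norm j k f = (SUP x. \<bar>x\<bar> ^ j * cmod (nderiv k f x))"

lemma schwartz_norm_upper:
  "f \<in> schwartz_space \<Longrightarrow> \<bar>x\<bar> ^ j * cmod (nderiv k f x) \<le> schwartz_norm j k f"
  unfolding schwartz_norm_def by (rule cSUP_upper) (auto simp: schwartz_space_def)

lemma schwartz_norm_nonneg: "f \<in> schwartz_space \<Longrightarrow> 0 \<le> schwartz_norm j k f"
  by (rule order_trans[OF _ schwartz_norm_upper[of f 0]]) auto

lemma schwartz_space_add:
  assumes "f \<in> schwartz_space" "g \<in> schwartz_space"
  shows "(\<lambda>x. f x + g x) \<in> schwartz_space"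
proof -
  have s: "smooth f" "smooth g" using assms by (auto simp: schwartz_space_def)
  have "\<bar>x\<bar> ^ j * cmod (nderiv k f x + nderiv k g x) \<le> schwartz_norm j k f + schwartz_norm j k g" for j k x
  proof -
    have "\<bar>x\<bar> ^ j * cmod (nderiv k f x + nderiv k g x) \<le> \<bar>x\<bar> ^ j * cmod (nderiv k f x) + \<bar>x\<bar> ^ j * cmod (nderiv k g x)"
      unfolding distrib_left[symmetric] by (intro mult_left_mono norm_triangle_ineq) auto
    then show ?thesis using schwartz_norm_upper[OF assms(1)] schwartz_norm_upper[OF assms(2)] by (smt (verit))
  qed
  then show ?thesis
    by (auto simp: schwartz_space_def smooth_add s nderiv_add intro!: bdd_aboveI2)
qed

lemma schwartz_space_cmult:
  assumes "f \<in> schwartz_space"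
  shows "(\<lambda>x. c * f x) \<in> schwartz_space"
proof -
  have s: "smooth f" using assms by (auto simp: schwartz_space_def)
  have "\<bar>x\<bar> ^ j * cmod (c * nderiv k f x) \<le> cmod c * schwartz_norm j k f" for j k x
    using mult_left_mono[OF schwartz_norm_upper[OF assms, of x j k], of "cmod c"]
    by (simp add: norm_mult mult_ac)
  then show ?thesis
    by (auto simp: schwartz_space_def smooth_mult smooth_const s nderiv_cmult simp del: norm_mult intro!: bdd_aboveI2)
qed

lemma schwartz_space_diff:
  "f \<in> schwartz_space \<Longrightarrow> g \<in> schwartz_space \<Longrightarrow> (\<lambda>x. f x - g x) \<in> schwartz_space"
  using schwartz_space_add[of f "\<lambda>x. - 1 * g x"] schwartz_space_cmult[of g "-1"] by simp

lemma Z_space_diff: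
  assumes "\<phi> \<in> Z_space" "\<psi> \<in> Z_space"
  shows "(\<lambda>x. \<phi> x - \<psi> x) \<in> Z_space"
proof -
  obtain g r where g: "0 < r" "g holomorphic_on UNIV" "\<And>x. g (of_real x) = \<phi> x"
    "\<And>n::nat. \<exists>C. \<forall>z. cmod (g z) \<le> C * exp (r * \<bar>Im z\<bar>) / (1 + cmod z) ^ n"
    using assms(1) unfolding Z_space_def by auto
  obtain g' r' where g': "0 < r'" "g' holomorphic_on UNIV" "\<And>x. g' (of_real x) = \<psi> x"
    "\<And>n::nat. \<exists>C. \<forall>z. cmod (g' z) \<le> C * exp (r' * \<bar>Im z\<bar>) / (1 + cmod z) ^ n"
    using assms(2) unfolding Z_space_def by auto
  have "\<exists>C. \<forall>z. cmod (g z - g' z) \<le> C * exp (max r r' * \<bar>Im z\<bar>) / (1 + cmod z) ^ n" for n :: nat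
  proof -
    obtain C where C: "\<And>z. cmod (g z) \<le> C * exp (r * \<bar>Im z\<bar>) / (1 + cmod z) ^ n" using g(4) by blast
    obtain C' where C': "\<And>z. cmod (g' z) \<le> C' * exp (r' * \<bar>Im z\<bar>) / (1 + cmod z) ^ n" using g'(4) by blast
    \<comment> \<open>Both growth rates are raised to the larger one. \<open>Z_space\<close> records
      no sign of its constants, hence the absolute value.\<close>
    have mono: "c * exp (s * \<bar>Im z\<bar>) / (1 + cmod z) ^ n \<le> \<bar>c\<bar> * exp (max r r' * \<bar>Im z\<bar>) / (1 + cmod z) ^ n"
      if "s \<le> max r r'" for c s z
      by (intro divide_right_mono mult_mono) (use that in \<open>auto intro: mult_right_mono\<close>)
    have "cmod (g z - g' z) \<le> (\<bar>C\<bar> + \<bar>C'\<bar>) * exp (max r r' * \<bar>Im z\<bar>) / (1 + cmod z) ^ n" for z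
      using norm_triangle_ineq4[of "g z" "g' z"] C[of z] C'[of z] mono[of r C z] mono[of r' C' z]
      by (simp add: distrib_right add_divide_distrib)
    then show ?thesis by blast
  qed
  then show ?thesis
    unfolding Z_space_def mem_Collect_eq
    using assms g(1-3) g'(1-3)
    by (intro conjI schwartz_space_diff exI[of _ "\<lambda>z. g z - g' z"] exI[of _ "max r r'"])
      (auto simp: Z_space_def intro: holomorphic_intros)
qed

lemma Z_space_subset: "Z_space \<subseteq> schwartz_space"
  by (auto simp: Z_space_def)

section \<open>Fourier transforms of test functions\<close>

text \<open>On a compact interval differentiation under the integral and partial integration are
  directly available. For functions vanishing when \<open>|y| \<ge> R\<close> this is the full
  transform up to its constant.\<close>

definition fourier_on :: "real \<Rightarrow> (real \<Rightarrow> complex) \<Rightarrow> real \<Rightarrow> complex" where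
  "fourier_on R f x = integral {-R..R} (\<lambda>y. exp (- \<i> * of_real (x * y)) * f y)"

lemma fourier_on_integrable:
  "continuous_on UNIV f \<Longrightarrow> (\<lambda>y. exp (- \<i> * of_real (x * y)) * f y) integrable_on {a..b}"
  by (intro integrable_continuous_real continuous_intros) (auto intro: continuous_on_subset)

lemma fourier_eq_fourier_on:
  assumes "continuous_on UNIV f" "\<And>y. \<bar>y\<bar> \<ge> R \<Longrightarrow> f y = 0"
  shows "fourier f x = of_real (1 / sqrt (2 * pi)) * fourier_on R f x"
proof -
  have "(LINT y|lborel. exp (- \<i> * of_real (x * y)) * f y) = fourier_on R f x"
    unfolding fourier_on_def
    by (rule lborel_integral_eq_integral)
      (auto intro!: continuous_intros continuous_on_subset[OF assms(1)] assms(2))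
  then show ?thesis by (simp add: fourier_def)
qed

lemma fourier_on_deriv:
  assumes "continuous_on UNIV f"
  shows "(fourier_on R f has_vector_derivative fourier_on R (\<lambda>y. - \<i> * of_real y * f y) x) (at x)"
proof -
  have "((\<lambda>x. integral (cbox (-R) R) (\<lambda>y. exp (- \<i> * of_real (x * y)) * f y)) has_vector_derivative
      integral (cbox (-R) R) (\<lambda>y. exp (- \<i> * of_real (x * y)) * (- \<i> * of_real y * f y))) (at x within UNIV)"
  proof (rule leibniz_rule_vector_derivative[where
        fx = "\<lambda>x y. exp (- \<i> * of_real (x * y)) * (- \<i> * of_real y * f y)" and
        f = "\<lambda>x y. exp (- \<i> * of_real (x * y)) * f y"])
    fix x y :: real
    have "((\<lambda>x. exp (- \<i> * of_real y * of_real x)) has_vector_derivative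
        exp (- \<i> * of_real y * of_real x) * (- \<i> * of_real y)) (at x)"
      by (rule has_vector_derivative_real_field) (auto intro!: derivative_eq_intros)
    from bounded_linear.has_vector_derivative[OF bounded_linear_mult_left this, of "f y"]
    show "((\<lambda>x. exp (- \<i> * of_real (x * y)) * f y) has_vector_derivative
        exp (- \<i> * of_real (x * y)) * (- \<i> * of_real y * f y)) (at x within UNIV)"
      by (simp add: mult_ac)
  next
    fix x show "(\<lambda>y. exp (- \<i> * of_real (x * y)) * f y) integrable_on cbox (- R) R"
      using fourier_on_integrable[OF assms] by simp
  next
    show "continuous_on (UNIV \<times> cbox (- R) R) (\<lambda>(x, y). exp (- \<i> * of_real (x * y)) * (- \<i> * of_real y * f y))"
      unfolding case_prod_beta by (intro continuous_intros continuous_on_compose2[OF assms]) auto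
  qed auto
  then show ?thesis unfolding fourier_on_def[abs_def] by simp
qed

text \<open>Carries the factor that \<open>k\<close> differentiations of the exponential kernel
  bring down.\<close>

definition mono_mult :: "nat \<Rightarrow> (real \<Rightarrow> complex) \<Rightarrow> real \<Rightarrow> complex" where
  "mono_mult k f y = (- \<i> * of_real y) ^ k * f y"

lemma mono_mult_0 [simp]: "mono_mult 0 f = f"
  by (simp add: mono_mult_def[abs_def])

lemma smooth_mono_mult: "smooth f \<Longrightarrow> smooth (mono_mult k f)"
proof -
  assume f: "smooth f"
  have "smooth (\<lambda>y. of_real y)" by (simp add: smooth_iff_diffn diffn_of_real diffn_ident)
  then have "smooth (\<lambda>y. - \<i> * of_real y)" by (rule smooth_mult[OF smooth_const])
  then have "smooth (\<lambda>y. (- \<i> * of_real y) ^ k)"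
    by (induction k) (simp_all only: power_0 power_Suc smooth_const smooth_mult)
  then show ?thesis unfolding mono_mult_def[abs_def] by (rule smooth_mult) (rule f)
qed

lemma fourier_on_mono_deriv:
  assumes "smooth f"
  shows "(fourier_on R (mono_mult k f) has_vector_derivative fourier_on R (mono_mult (Suc k) f) x) (at x)"
  using fourier_on_deriv[OF smooth_continuous[OF smooth_mono_mult[OF assms]], of R k x]
  by (simp add: mono_mult_def[abs_def] mult.assoc)

lemma smooth_fourier_on: "smooth f \<Longrightarrow> smooth (fourier_on R f)"
  by (rule smooth_derivs[of "\<lambda>k. fourier_on R (mono_mult k f)"]) (simp_all add: fourier_on_mono_deriv)

lemma nderiv_fourier_on: "smooth f \<Longrightarrow> nderiv k (fourier_on R f) = fourier_on R (mono_mult k f)"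
  by (rule nderiv_unique[of "\<lambda>k. fourier_on R (mono_mult k f)"]) (simp_all add: fourier_on_mono_deriv)

lemma fourier_on_by_parts:
  assumes "smooth f" "f R = 0" "f (-R) = 0" "R > 0"
  shows "\<i> * of_real x * fourier_on R f x = fourier_on R (nderiv 1 f) x"
proof -
  let ?e = "\<lambda>y. exp (- \<i> * of_real (x * y))"
  have "((\<lambda>y. ?e y * f y) has_vector_derivative
      ?e y * nderiv 1 f y + (?e y * (- \<i> * of_real x)) * f y) (at y within {-R..R})" for y
  proof -
    have "((\<lambda>y. exp (- \<i> * of_real x * of_real y)) has_vector_derivative
        exp (- \<i> * of_real x * of_real y) * (- \<i> * of_real x)) (at y)"
      by (rule has_vector_derivative_real_field) (auto intro!: derivative_eq_intros)
    then have "(?e has_vector_derivative ?e y * (- \<i> * of_real x)) (at y)"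
      by (simp add: mult.assoc)
    moreover have "(f has_vector_derivative nderiv 1 f y) (at y)"
      using smooth_nderiv_deriv[OF assms(1), of 0] by simp
    ultimately have "((\<lambda>y. ?e y * f y) has_vector_derivative
        ?e y * nderiv 1 f y + (?e y * (- \<i> * of_real x)) * f y) (at y)"
      by (rule has_vector_derivative_mult)
    then show ?thesis by (rule has_vector_derivative_at_within)
  qed
  then have "((\<lambda>y. ?e y * nderiv 1 f y + (?e y * (- \<i> * of_real x)) * f y) has_integral (?e R * f R - ?e (-R) * f (-R))) {-R..R}"
    using assms(4) by (intro fundamental_theorem_of_calculus) auto
  then have 1: "((\<lambda>y. ?e y * nderiv 1 f y + (?e y * (- \<i> * of_real x)) * f y) has_integral 0) {-R..R}"
    using assms(2,3) by simp
  have 2: "((\<lambda>y. ?e y * f y) has_integral fourier_on R f x) {-R..R}"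
    unfolding fourier_on_def by (intro integrable_integral fourier_on_integrable smooth_continuous assms(1))
  have "((\<lambda>y. (?e y * nderiv 1 f y + (?e y * (- \<i> * of_real x)) * f y) + \<i> * of_real x * (?e y * f y))
      has_integral (0 + \<i> * of_real x * fourier_on R f x)) {-R..R}"
    by (intro has_integral_add has_integral_mult_right 1 2)
  moreover have "(E * d + (E * (- \<i> * X)) * u) + \<i> * X * (E * u) = E * d" for E d X u :: complex
    by (simp add: algebra_simps)
  ultimately have "((\<lambda>y. ?e y * nderiv 1 f y) has_integral (\<i> * of_real x * fourier_on R f x)) {-R..R}"
    by (simp only: add_0)
  from integral_unique[OF this] show ?thesis by (simp add: fourier_on_def)
qed

text \<open>At the endpoints \<open>|y| = R\<close> no neighbourhood argument is available; the
  value there is a limit of zeros from outside, by continuity of the derivative. These endpoint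
  values are the boundary terms of the partial integrations.\<close>

lemma nderiv_zero_ge:
  assumes "smooth f" "\<And>y. \<bar>y\<bar> \<ge> R \<Longrightarrow> f y = 0" "\<bar>y\<bar> \<ge> R" "R > 0"
  shows "nderiv n f y = 0"
proof -
  have "nderiv n f y = 0" if "\<bar>y\<bar> > R" for y
    by (rule nderiv_zero_outside[of "-R" R]) (use assms(2) that in auto)
  then have *: "{y. \<bar>y\<bar> > R} \<subseteq> {y. nderiv n f y = 0}" by auto
  have "closed {y. nderiv n f y = 0}"
    by (intro closed_Collect_eq continuous_nderiv assms(1) continuous_intros)
  then have "closure {y. \<bar>y\<bar> > R} \<subseteq> {y. nderiv n f y = 0}" using * by (rule closure_minimal[rotated])
  moreover have "y \<in> closure {y. \<bar>y\<bar> > R}"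
  proof (rule Lim_in_closed_set)
    show "closed (closure {y. \<bar>y\<bar> > R})" by simp
    show "\<forall>\<^sub>F s in at_right 1. s * y \<in> closure {y. \<bar>y\<bar> > R}"
    proof (rule eventually_mono[OF eventually_at_right_less[of 1]])
      fix s :: real assume "1 < s"
      then have "1 * \<bar>y\<bar> < s * \<bar>y\<bar>" using assms(3,4) by (intro mult_strict_right_mono) auto
      then have "R < \<bar>s * y\<bar>" using assms(3) \<open>1 < s\<close> by (simp add: abs_mult)
      then show "s * y \<in> closure {y. \<bar>y\<bar> > R}" by (intro subsetD[OF closure_subset]) simp
    qed
    have "((\<lambda>s. s * y) \<longlongrightarrow> 1 * y) (at_right 1)" by (intro tendsto_intros)
    then show "((\<lambda>s. s * y) \<longlongrightarrow> y) (at_right 1)" by simp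
  qed simp
  ultimately show ?thesis by blast
qed

lemma norm_fourier_on_power:
  assumes "smooth f" "\<And>y. \<bar>y\<bar> \<ge> R \<Longrightarrow> f y = 0" "R > 0"
  shows "\<bar>x\<bar> ^ j * cmod (fourier_on R f x) = cmod (fourier_on R (nderiv j f) x)"
proof (induction j)
  case (Suc j)
  have "\<i> * of_real x * fourier_on R (nderiv j f) x = fourier_on R (nderiv 1 (nderiv j f)) x"
    by (intro fourier_on_by_parts smooth_nderiv nderiv_zero_ge assms) (use assms in auto)
  then have "cmod (\<i> * of_real x * fourier_on R (nderiv j f) x) = cmod (fourier_on R (nderiv (Suc j) f) x)"
    using nderiv_nderiv[OF assms(1), of 1 j] by simp
  then show ?case using Suc by (simp add: norm_mult mult.assoc)
qed simp

lemma norm_fourier_on_le: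
  assumes "continuous_on UNIV f" "\<And>y. cmod (f y) \<le> B" "R > 0"
  shows "cmod (fourier_on R f x) \<le> 2 * R * B"
proof -
  have "cmod (fourier_on R f x) \<le> B * (R - - R)"
    unfolding fourier_on_def
    by (rule integral_bound)
     (use assms in \<open>auto intro!: continuous_intros continuous_on_subset[OF assms(1)] simp: norm_mult\<close>)
  then show ?thesis by (simp add: mult_ac)
qed

lemma compact_support_radius:
  assumes "compact (K :: real set)"
  obtains R where "R > 0" "\<And>f y. supp f \<subseteq> K \<Longrightarrow> \<bar>y\<bar> \<ge> R \<Longrightarrow> f y = 0"
proof -
  obtain R where R: "0 < R" "\<And>x. x \<in> K \<Longrightarrow> \<bar>x\<bar> \<le> R"
    using compact_imp_bounded[OF assms] unfolding bounded_pos by auto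
  show ?thesis
  \<comment> \<open>One unit beyond the bound for \<open>K\<close>, so that functions supported in
    \<open>K\<close> vanish at the endpoints as well.\<close>
  proof (rule that[of "R + 1"])
    fix f y assume "supp f \<subseteq> K" "\<bar>y\<bar> \<ge> R + 1"
    then show "f y = 0" using R(2)[of y] by (intro supp_zero) auto
  qed (use R in simp)
qed

lemma fourier_derivs:
  assumes "smooth f" "\<And>y. \<bar>y\<bar> \<ge> R \<Longrightarrow> f y = 0" "R > 0"
  shows "smooth (fourier f)"
    and "\<bar>x\<bar> ^ j * cmod (nderiv k (fourier f) x) =
      1 / sqrt (2 * pi) * cmod (fourier_on R (nderiv j (mono_mult k f)) x)"
proof -
  let ?c = "of_real (1 / sqrt (2 * pi)) :: complex"
  have eq: "fourier f = (\<lambda>x. ?c * fourier_on R f x)"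
    using fourier_eq_fourier_on[OF smooth_continuous[OF assms(1)] assms(2)] by blast
  show "smooth (fourier f)" unfolding eq by (intro smooth_mult smooth_const smooth_fourier_on assms(1))
  have "nderiv k (fourier f) x = ?c * fourier_on R (mono_mult k f) x"
    unfolding eq nderiv_cmult[OF smooth_fourier_on[OF assms(1)]] nderiv_fourier_on[OF assms(1)] ..
  then have "\<bar>x\<bar> ^ j * cmod (nderiv k (fourier f) x) = 1 / sqrt (2 * pi) * (\<bar>x\<bar> ^ j * cmod (fourier_on R (mono_mult k f) x))"
    by (simp add: norm_mult norm_divide)
  also have "\<bar>x\<bar> ^ j * cmod (fourier_on R (mono_mult k f) x) = cmod (fourier_on R (nderiv j (mono_mult k f)) x)"
    by (intro norm_fourier_on_power smooth_mono_mult assms) (simp add: mono_mult_def assms(2))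
  finally show "\<bar>x\<bar> ^ j * cmod (nderiv k (fourier f) x) =
      1 / sqrt (2 * pi) * cmod (fourier_on R (nderiv j (mono_mult k f)) x)" .
qed

lemma fourier_schwartz_norm_le:
  assumes "smooth f" "\<And>y. \<bar>y\<bar> \<ge> R \<Longrightarrow> f y = 0" "R > 0"
    and "\<And>y. cmod (nderiv j (mono_mult k f) y) \<le> B"
  shows "\<bar>x\<bar> ^ j * cmod (nderiv k (fourier f) x) \<le> 2 * R * B"
proof -
  have "cmod (fourier_on R (nderiv j (mono_mult k f)) x) \<le> 2 * R * B"
    by (intro norm_fourier_on_le continuous_nderiv smooth_mono_mult assms)
  moreover have "1 / sqrt (2 * pi) \<le> 1"
    using pi_gt3 by (simp add: field_simps)
  ultimately have "1 / sqrt (2 * pi) * cmod (fourier_on R (nderiv j (mono_mult k f)) x) \<le> 1 * (2 * R * B)"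
    by (intro mult_mono) auto
  then show ?thesis
    using fourier_derivs(2)[OF assms(1-3)] by simp
qed

lemma fourier_schwartz:
  assumes "f \<in> test_space UNIV"
  shows "fourier f \<in> schwartz_space"
proof -
  note s = test_space_smooth[OF assms]
  obtain R where R: "R > 0" "\<And>y. \<bar>y\<bar> \<ge> R \<Longrightarrow> f y = 0"
  proof -
    have "compact (supp f)" using assms by (simp add: test_space_def)
    then obtain R where "R > 0" "\<And>g y. supp g \<subseteq> supp f \<Longrightarrow> \<bar>y\<bar> \<ge> R \<Longrightarrow> (g y :: complex) = 0"
      using compact_support_radius by metis
    then show ?thesis using that by blast
  qed
  have T: "mono_mult k f \<in> test_space UNIV" for k
    by (rule test_spaceI[OF smooth_mono_mult[OF s], of "-R" R]) (use R(2) in \<open>auto simp: mono_mult_def\<close>)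
  have "bdd_above (range (\<lambda>x. \<bar>x\<bar> ^ j * cmod (nderiv k (fourier f) x)))" for j k
    using fourier_schwartz_norm_le[OF s R(2,1) norm_nderiv_le_SUP[OF T]] by (intro bdd_aboveI2) blast
  then show ?thesis using fourier_derivs(1)[OF s R(2,1)] by (simp add: schwartz_space_def)
qed

lemma fourier_add:
  assumes "f \<in> test_space UNIV" "g \<in> test_space UNIV"
  shows "fourier (\<lambda>y. f y + g y) = (\<lambda>x. fourier f x + fourier g x)"
proof
  fix x
  have "compact (supp f \<union> supp g)" using assms by (auto simp: test_space_def)
  then obtain R where R: "R > 0" "\<And>u y. supp u \<subseteq> supp f \<union> supp g \<Longrightarrow> \<bar>y\<bar> \<ge> R \<Longrightarrow> (u y :: complex) = 0"
    using compact_support_radius by metis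
  have c: "continuous_on UNIV f" "continuous_on UNIV g"
    using assms test_space_smooth smooth_continuous by blast+
  have z: "f y = 0" "g y = 0" if "\<bar>y\<bar> \<ge> R" for y using R(2) that by auto
  have "fourier_on R (\<lambda>y. f y + g y) x = fourier_on R f x + fourier_on R g x"
    unfolding fourier_on_def distrib_left by (intro integral_add fourier_on_integrable c)
  then show "fourier (\<lambda>y. f y + g y) x = fourier f x + fourier g x"
    using fourier_eq_fourier_on[OF c(1) z(1)] fourier_eq_fourier_on[OF c(2) z(2)]
      fourier_eq_fourier_on[of "\<lambda>y. f y + g y" R] z c
    by (simp add: continuous_on_add distrib_left add_divide_distrib)
qed

lemma fourier_cmult: "fourier (\<lambda>y. c * f y) = (\<lambda>x. c * fourier f x)"
  unfolding fourier_def by (simp add: mult.left_commute[of _ c])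

lemma nderiv_mono_mult_1:
  assumes "smooth f"
  shows "nderiv 1 (mono_mult 1 f) = (\<lambda>y. - \<i> * f y + mono_mult 1 (nderiv 1 f) y)"
proof
  fix y
  have "((\<lambda>y. - \<i> * of_real y) has_vector_derivative - \<i>) (at y)"
    by (rule has_vector_derivative_real_field[where f = "\<lambda>z. - \<i> * z"]) (auto intro!: derivative_eq_intros)
  moreover have "(f has_vector_derivative nderiv 1 f y) (at y)"
    using smooth_nderiv_deriv[OF assms, of 0] by simp
  ultimately have "((\<lambda>y. (- \<i> * of_real y) * f y) has_vector_derivative
      (- \<i> * of_real y) * nderiv 1 f y + (- \<i>) * f y) (at y)"
    by (rule has_vector_derivative_mult)
  then have "(mono_mult 1 f has_vector_derivative - \<i> * f y + mono_mult 1 (nderiv 1 f) y) (at y)"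
    by (simp add: mono_mult_def[abs_def] add.commute)
  then show "nderiv 1 (mono_mult 1 f) y = - \<i> * f y + mono_mult 1 (nderiv 1 f) y"
    by (simp add: nderiv_Suc vector_derivative_at)
qed

lemma nderiv_mono_mult_2:
  assumes "smooth f"
  shows "nderiv 2 (mono_mult 1 f) = (\<lambda>y. - 2 * \<i> * nderiv 1 f y + mono_mult 1 (nderiv 2 f) y)"
proof -
  note s = smooth_nderiv[OF assms, of 1]
  have "nderiv 2 (mono_mult 1 f) = nderiv 1 (nderiv 1 (mono_mult 1 f))"
    by (simp add: nderiv_nderiv smooth_mono_mult assms numeral_2_eq_2)
  also have "\<dots> = (\<lambda>y. nderiv 1 (\<lambda>y. - \<i> * f y) y + nderiv 1 (mono_mult 1 (nderiv 1 f)) y)"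
    unfolding nderiv_mono_mult_1[OF assms]
    by (rule nderiv_add) (intro smooth_mult smooth_const smooth_mono_mult assms s)+
  also have "\<dots> = (\<lambda>y. - 2 * \<i> * nderiv 1 f y + mono_mult 1 (nderiv 2 f) y)"
    unfolding nderiv_mono_mult_1[OF s] nderiv_cmult[OF assms]
    using nderiv_nderiv[OF assms, of 1 1] by (simp add: numeral_2_eq_2 mult.assoc)
  finally show ?thesis .
qed

text \<open>These control \<open>(1 + |x|)^2\<close> times \<Omega> and its first derivative, which
  is what \<open>weighted_series_bound\<close> asks for after the substitution
  \<open>x = ln t\<close>. They form a finite set to fit
  \<open>continuous_map_lc_topology\<close>.\<close>

definition four_norms :: "((real \<Rightarrow> complex) \<Rightarrow> real) set" where
  "four_norms = {schwartz_norm j k | j k. j \<in> {0, 2} \<and> k \<in> {0, 1}}"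

lemma four_norms_eq:
  "four_norms = {schwartz_norm 0 0, schwartz_norm 2 0, schwartz_norm 0 1, schwartz_norm 2 1}"
  by (auto simp: four_norms_def)

text \<open>The worst case is the second derivative of \<open>- \<i> * y * f y\<close>, bounded by
  \<open>2 + R\<close> times the sum on the right; integration over \<open>{-R..R}\<close> adds the
  factor \<open>2 * R\<close>.\<close>

lemma fourier_four_norms:
  assumes "compact K"
  obtains C where "C \<ge> 0" "\<And>f p. f \<in> test_space UNIV \<Longrightarrow> supp f \<subseteq> K \<Longrightarrow> p \<in> four_norms \<Longrightarrow>
    p (fourier f) \<le> C * (\<Sum>n\<le>2. SUP x. cmod (nderiv n f x))"
proof -
  obtain R where R: "R > 0" "\<And>f y. supp f \<subseteq> K \<Longrightarrow> \<bar>y\<bar> \<ge> R \<Longrightarrow> (f y :: complex) = 0"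
    using compact_support_radius[OF assms] by metis
  show ?thesis
  proof (rule that[of "2 * R * (2 + R)"])
    fix f p assume f: "f \<in> test_space UNIV" "supp f \<subseteq> K" and p: "p \<in> four_norms"
    let ?S = "\<Sum>n\<le>2. SUP x. cmod (nderiv n f x)"
    note s = test_space_smooth[OF f(1)] and z = R(2)[OF f(2)]
    have nn: "0 \<le> (SUP x. cmod (nderiv n f x))" for n
      by (rule order_trans[OF norm_ge_zero norm_nderiv_le_SUP[OF f(1)]])
    have le: "cmod (nderiv n f y) \<le> ?S" if "n \<le> 2" for n y
    proof -
      have "(SUP x. cmod (nderiv n f x)) \<le> ?S" by (rule member_le_sum) (use nn that in auto)
      then show ?thesis using norm_nderiv_le_SUP[OF f(1)] by (rule order_trans[rotated])
    qed
    have S0: "?S \<ge> 0" by (intro sum_nonneg nn)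
    have leR: "cmod (mono_mult 1 (nderiv n f) y) \<le> R * ?S" if n: "n \<le> 2" for n y
    proof (cases "\<bar>y\<bar> \<ge> R")
      case True
      then have "nderiv n f y = 0" using nderiv_zero_ge[of f R y n] s z R(1) by blast
      then show ?thesis using S0 R(1) by (simp add: mono_mult_def)
    next
      case False
      then show ?thesis using le[OF n, of y] by (auto simp: mono_mult_def norm_mult intro: mult_mono)
    qed
    have B: "cmod (nderiv j (mono_mult k f) y) \<le> (2 + R) * ?S" if "j \<in> {0, 2}" "k \<in> {0, 1}" for j k y
    proof -
      have 1: "?S \<le> (2 + R) * ?S" "R * ?S \<le> (2 + R) * ?S" using S0 R(1) by (auto intro: mult_right_mono simp: distrib_right)
      have "cmod (- 2 * \<i> * nderiv 1 f y + mono_mult 1 (nderiv 2 f) y) \<le> (2 + R) * ?S"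
        by (rule norm_triangle_le) (use le[of 1 y] leR[of 2 y] in \<open>simp add: norm_mult distrib_right\<close>)
      then have 2: "cmod (nderiv 2 (mono_mult 1 f) y) \<le> (2 + R) * ?S"
        by (simp only: nderiv_mono_mult_2[OF s])
      have 3: "cmod (mono_mult 1 f y) \<le> (2 + R) * ?S" using leR[of 0 y] 1(2) by simp
      have 4: "cmod (f y) \<le> (2 + R) * ?S" "cmod (nderiv 2 f y) \<le> (2 + R) * ?S"
        using le[of 0 y] le[of 2 y] 1(1) by simp_all
      show ?thesis using that 2 3 4 by (elim insertE emptyE; simp only: nderiv_0 mono_mult_0)
    qed
    obtain j k where jk: "p = schwartz_norm j k" "j \<in> {0, 2}" "k \<in> {0, 1}"
      using p by (auto simp: four_norms_def)
    have "\<bar>x\<bar> ^ j * cmod (nderiv k (fourier f) x) \<le> 2 * R * ((2 + R) * ?S)" for x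
      by (rule fourier_schwartz_norm_le[OF s z R(1) B[OF jk(2,3)]])
    then have "p (fourier f) \<le> 2 * R * ((2 + R) * ?S)"
      unfolding jk schwartz_norm_def by (intro cSUP_least) auto
    then show "p (fourier f) \<le> 2 * R * (2 + R) * ?S" by (simp add: mult.assoc)
  qed (use R(1) in simp)
qed

section \<open>Extension to a tempered distribution\<close>

context hankel_form
begin

lemma diffn_comp_ln: "smooth \<Omega> \<Longrightarrow> diffn n {0<..} (\<lambda>t. \<Omega> (ln t))"
  by (rule diffn_compose[where V = UNIV]) (auto simp: smooth_iff_diffn diffn_ln)

text \<open>In the variable \<open>x = ln t\<close> the operator \<open>t * d/dt\<close> becomes
  \<open>d/dx\<close>, so the logarithmic weights on the half-line turn into polynomial weights on
  the line.\<close>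

lemma log_extension_bound:
  obtains K where "K \<ge> 0" "\<And>\<Omega>. \<Omega> \<in> schwartz_space \<Longrightarrow> summable (\<lambda>m. h (\<lambda>t. pair_bump m t * \<Omega> (ln t)))"
    "\<And>\<Omega>. \<Omega> \<in> schwartz_space \<Longrightarrow> cmod (log_extension \<Omega>) \<le> K * (\<Sum>p\<in>four_norms. p \<Omega>)"
proof -
  obtain K where K: "K \<ge> 0"
    "\<And>F F' S. (\<And>n. diffn n {0<..} F) \<Longrightarrow> (\<And>t. t > 0 \<Longrightarrow> (F has_vector_derivative F' t) (at t)) \<Longrightarrow>
      (\<And>t. t > 0 \<Longrightarrow> (1 + \<bar>ln t\<bar>)\<^sup>2 * cmod (F t) \<le> S) \<Longrightarrow>
      (\<And>t. t > 0 \<Longrightarrow> (1 + \<bar>ln t\<bar>)\<^sup>2 * (t * cmod (F' t)) \<le> S) \<Longrightarrow>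
      summable (\<lambda>m. h (\<lambda>t. pair_bump m t * F t)) \<and>
      cmod (\<Sum>m. h (\<lambda>t. pair_bump m t * F t)) \<le> K * S"
    by (rule weighted_series_bound) blast
  have *: "summable (\<lambda>m. h (\<lambda>t. pair_bump m t * \<Omega> (ln t))) \<and>
      cmod (\<Sum>m. h (\<lambda>t. pair_bump m t * \<Omega> (ln t))) \<le> K * (4 * (\<Sum>p\<in>four_norms. p \<Omega>))"
    if \<Omega>: "\<Omega> \<in> schwartz_space" for \<Omega>
  proof (rule K(2))
    let ?q = "\<Sum>p\<in>four_norms. p \<Omega>"
    have s: "smooth \<Omega>" using \<Omega> by (simp add: schwartz_space_def)
    have mem: "schwartz_norm j k \<Omega> \<le> ?q" if "j \<in> {0, 2}" "k \<in> {0, 1}" for j k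
    proof (rule member_le_sum)
      show "schwartz_norm j k \<in> four_norms" using that by (auto simp: four_norms_def)
      show "finite four_norms" by (simp add: four_norms_eq)
      show "0 \<le> p \<Omega>" if "p \<in> four_norms - {schwartz_norm j k}" for p
        using that schwartz_norm_nonneg[OF \<Omega>] by (auto simp: four_norms_def)
    qed
    have b: "(1 + \<bar>x\<bar>)\<^sup>2 * cmod (nderiv k \<Omega> x) \<le> 4 * ?q" if k: "k \<in> {0, 1}" for k x
    proof -
      \<comment> \<open>Equivalent to \<open>(1 - |x|)^2 \<ge> 0\<close>; it splits the weight into
        the two powers available in \<open>four_norms\<close>.\<close>
      have "(1 + \<bar>x\<bar>)\<^sup>2 \<le> 2 * (1 + \<bar>x\<bar>\<^sup>2)"
        using zero_le_power2[of "1 - \<bar>x\<bar>"] by (simp add: power2_eq_square algebra_simps)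
      then have "(1 + \<bar>x\<bar>)\<^sup>2 * cmod (nderiv k \<Omega> x) \<le> 2 * (1 + \<bar>x\<bar>\<^sup>2) * cmod (nderiv k \<Omega> x)"
        by (rule mult_right_mono) simp
      also have "\<dots> = 2 * (\<bar>x\<bar> ^ 0 * cmod (nderiv k \<Omega> x) + \<bar>x\<bar> ^ 2 * cmod (nderiv k \<Omega> x))"
        by (simp add: algebra_simps)
      also have "\<dots> \<le> 2 * (?q + ?q)"
        by (intro mult_left_mono add_mono order_trans[OF schwartz_norm_upper[OF \<Omega>] mem] k) auto
      finally show ?thesis by simp
    qed
    show "diffn n {0<..} (\<lambda>t. \<Omega> (ln t))" for n by (rule diffn_comp_ln[OF s])
    show "((\<lambda>t. \<Omega> (ln t)) has_vector_derivative (1 / t) *\<^sub>R nderiv 1 \<Omega> (ln t)) (at t)" if "t > 0" for t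
    proof -
      have "(ln has_vector_derivative (1 / t)) (at t)"
        using that by (auto simp: has_real_derivative_iff_has_vector_derivative[symmetric] intro!: derivative_eq_intros)
      from vector_diff_chain_at[OF this, of \<Omega> "nderiv 1 \<Omega> (ln t)"] smooth_nderiv_deriv[OF s, of 0 "ln t"]
      show ?thesis by (simp add: o_def)
    qed
    show "(1 + \<bar>ln t\<bar>)\<^sup>2 * cmod (\<Omega> (ln t)) \<le> 4 * ?q" for t using b[of 0 "ln t"] by simp
    show "(1 + \<bar>ln t\<bar>)\<^sup>2 * (t * cmod ((1 / t) *\<^sub>R nderiv 1 \<Omega> (ln t))) \<le> 4 * ?q" if "t > 0" for t
      using b[of 1 "ln t"] that by simp
  qed
  show ?thesis
    by (rule that[of "4 * K"]) (use * K(1) in \<open>auto simp: log_extension_def mult_ac\<close>)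
qed

lemma log_extension_summable: "\<Omega> \<in> schwartz_space \<Longrightarrow> summable (\<lambda>m. h (\<lambda>t. pair_bump m t * \<Omega> (ln t)))"
  by (rule log_extension_bound) blast

lemma log_extension_add:
  assumes "f \<in> schwartz_space" "g \<in> schwartz_space"
  shows "log_extension (\<lambda>x. f x + g x) = log_extension f + log_extension g"
proof -
  have s: "smooth f" "smooth g" using assms by (auto simp: schwartz_space_def)
  have sm: "summable (\<lambda>m. h (\<lambda>t. pair_bump m t * f (ln t)))" "summable (\<lambda>m. h (\<lambda>t. pair_bump m t * g (ln t)))"
    by (intro log_extension_summable assms)+
  have "h (\<lambda>t. pair_bump m t * (f (ln t) + g (ln t))) = h (\<lambda>t. pair_bump m t * f (ln t)) + h (\<lambda>t. pair_bump m t * g (ln t))" for m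
    unfolding distrib_left by (intro h_add pair_bump_mult_test_space diffn_comp_ln s)
  then show ?thesis unfolding log_extension_def by (simp add: suminf_add[OF sm])
qed

lemma log_extension_cmult:
  assumes "f \<in> schwartz_space"
  shows "log_extension (\<lambda>x. c * f x) = cnj c * log_extension f"
proof -
  have s: "smooth f" using assms by (auto simp: schwartz_space_def)
  have sm: "summable (\<lambda>m. h (\<lambda>t. pair_bump m t * f (ln t)))"
    by (intro log_extension_summable assms)
  have "h (\<lambda>t. pair_bump m t * (c * f (ln t))) = cnj c * h (\<lambda>t. pair_bump m t * f (ln t))" for m
    unfolding mult.left_commute[of _ c] by (intro h_cmult pair_bump_mult_test_space diffn_comp_ln s)
  then show ?thesis unfolding log_extension_def by (simp add: suminf_mult[OF sm])
qed

lemma log_extension_diff: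
  "f \<in> schwartz_space \<Longrightarrow> g \<in> schwartz_space \<Longrightarrow> log_extension (\<lambda>x. f x - g x) = log_extension f - log_extension g"
  using log_extension_add[of f "\<lambda>x. - 1 * g x"] log_extension_cmult[of g "-1"] schwartz_space_cmult[of g "-1"] by simp

lemma log_extension_antidual: "log_extension \<in> antidual schwartz_topology"
proof -
  obtain K where K: "K \<ge> 0"
    "\<And>\<Omega>. \<Omega> \<in> schwartz_space \<Longrightarrow> cmod (log_extension \<Omega>) \<le> K * (\<Sum>p\<in>four_norms. p \<Omega>)"
    by (rule log_extension_bound) blast
  have "continuous_map schwartz_topology euclidean log_extension"
    unfolding schwartz_topology_def
  proof (rule continuous_map_lc_topology[where Q = four_norms and C = K])
    show "four_norms \<subseteq> {\<lambda>f. SUP x. \<bar>x\<bar> ^ j * cmod (nderiv k f x) |j k. True}"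
      by (auto simp: four_norms_def schwartz_norm_def[abs_def])
    show "topspace (lc_topology schwartz_space {\<lambda>f. SUP x. \<bar>x\<bar> ^ j * cmod (nderiv k f x) |j k. True}) = schwartz_space"
      using topspace_schwartz_topology unfolding schwartz_topology_def .
    show "p (\<lambda>x. 0) = 0" if "p \<in> four_norms" for p
      using that by (auto simp: four_norms_def schwartz_norm_def nderiv_zero)
  qed (use K schwartz_space_diff log_extension_diff in \<open>auto simp: four_norms_eq\<close>)
  then show ?thesis unfolding antidual_iff using log_extension_add log_extension_cmult by simp
qed

text \<open>When \<Omega> has compact support, \<Omega>(ln t) extended by zero is a test function on
  the half-line, and the series is summed by \<open>suminf_pair_bump\<close>.\<close>

lemma log_extension_log_dist:
  assumes "\<Omega> \<in> test_space UNIV"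
  shows "log_extension \<Omega> = log_dist h \<Omega>"
proof -
  note s = test_space_smooth[OF assms]
  obtain R where R: "0 < R" "\<And>x. x \<notin> {-R..R} \<Longrightarrow> \<Omega> x = 0"
    by (rule test_space_UNIV_bounds[OF assms]) blast
  let ?F = "\<lambda>t. if 0 < t then \<Omega> (ln t) else 0"
  have z: "?F t = 0" if "t \<notin> {exp (-R)..exp R}" for t
  proof (cases "t > 0")
    case True
    have "ln t \<notin> {-R..R}"
    proof
      assume "ln t \<in> {-R..R}"
      then have "exp (-R) \<le> exp (ln t)" "exp (ln t) \<le> exp R" by auto
      then show False using that True by simp
    qed
    then show ?thesis using R(2) by simp
  qed simp
  have T: "?F \<in> test_space {0<..}"
  proof (rule test_spaceI[OF _ z])
    have "diffn n UNIV ?F" for n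
    proof -
      have "diffn n {0<..} ?F" by (rule diffn_cong[OF _ _ diffn_comp_ln[OF s]]) auto
      moreover have "diffn n {..<exp (-R)} ?F"
        by (rule diffn_cong[OF _ _ diffn_const[of _ _ 0]]) (use z in auto)
      ultimately have "diffn n ({0<..} \<union> {..<exp (-R)}) ?F" by (intro diffn_Un) auto
      moreover have "{0<..} \<union> {..<exp (-R)} = UNIV" by (auto simp: not_less) (smt (verit) exp_gt_zero)
      ultimately show ?thesis by simp
    qed
    then show "smooth ?F" by (simp add: smooth_iff_diffn)
    show "{exp (-R)..exp R} \<subseteq> {0<..}" by (auto intro: less_le_trans[OF exp_gt_zero])
  qed
  have b0: "bump k t = 0" if "\<not> 0 < t" for k t
    using that dyadic_pos[of k] by (intro bump_zero) auto
  have "(\<lambda>t. pair_bump m t * \<Omega> (ln t)) = (\<lambda>t. pair_bump m t * ?F t)" for m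
    by (auto simp: fun_eq_iff pair_bump_def b0)
  then show ?thesis
    unfolding log_extension_def log_dist_def using suminf_pair_bump[OF T] by simp
qed

lemma log_extension_Z_continuous: "continuous_map Z_topology euclidean log_extension"
  unfolding Z_topology_def
proof (rule continuous_map_lc_topology[where Q = "{\<lambda>f. cmod (log_extension f)}" and C = 1])
  note Z = subsetD[OF Z_space_subset]
  obtain K where K: "K \<ge> 0"
    "\<And>\<Omega>. \<Omega> \<in> schwartz_space \<Longrightarrow> cmod (log_extension \<Omega>) \<le> K * (\<Sum>p\<in>four_norms. p \<Omega>)"
    by (rule log_extension_bound) blast
  have e0: "log_extension (\<lambda>x. 0) = 0" using log_extension_cmult[OF zero_in_schwartz_space, of 0] by simp
  show "p (\<lambda>x. 0) = 0" if "p \<in> {\<lambda>f. cmod (log_extension f)}" for p using that e0 by simp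
  have 1: "seminorm_on Z_space (\<lambda>f. cmod (log_extension f))"
    by (auto simp: seminorm_on_def log_extension_add log_extension_cmult Z norm_mult norm_triangle_ineq)
  \<comment> \<open>\<open>log_extension\<close> is linear up to conjugation on all Schwartz
    functions, so it suffices here that \<open>fourier f\<close> is a Schwartz function.\<close>
  have 2: "seminorm_on (test_space UNIV) (\<lambda>f. cmod (log_extension (fourier f)))"
    by (auto simp: seminorm_on_def fourier_add fourier_cmult log_extension_add log_extension_cmult fourier_schwartz norm_mult norm_triangle_ineq)
  have 3: "\<exists>C N. \<forall>f\<in>test_space UNIV. supp f \<subseteq> K' \<longrightarrow> cmod (log_extension (fourier f)) \<le> C * (\<Sum>n\<le>(N::nat). SUP x. cmod (nderiv n f x))"
    if K': "compact K'" for K'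
  proof -
    obtain C where C: "C \<ge> 0" "\<And>f p. f \<in> test_space UNIV \<Longrightarrow> supp f \<subseteq> K' \<Longrightarrow> p \<in> four_norms \<Longrightarrow>
        p (fourier f) \<le> C * (\<Sum>n\<le>2. SUP x. cmod (nderiv n f x))"
      by (rule fourier_four_norms[OF K']) blast
    have "cmod (log_extension (fourier f)) \<le> K * (card four_norms * C) * (\<Sum>n\<le>2. SUP x. cmod (nderiv n f x))"
      if f: "f \<in> test_space UNIV" "supp f \<subseteq> K'" for f
    proof -
      have "(\<Sum>p\<in>four_norms. p (fourier f)) \<le> card four_norms * (C * (\<Sum>n\<le>2. SUP x. cmod (nderiv n f x)))"
        using sum_bounded_above[of four_norms "\<lambda>p. p (fourier f)"] C(2)[OF f] by simp
      from mult_left_mono[OF this K(1)] K(2)[OF fourier_schwartz[OF f(1)]]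
      show ?thesis by (simp add: mult.assoc)
    qed
    then show ?thesis by blast
  qed
  show "{\<lambda>f. cmod (log_extension f)} \<subseteq> {p. seminorm_on Z_space p \<and> (\<lambda>f. p (fourier f)) \<in> test_seminorms UNIV}"
    using 1 2 3 by (simp add: test_seminorms_def)
  show "topspace (lc_topology Z_space {p. seminorm_on Z_space p \<and> (\<lambda>f. p (fourier f)) \<in> test_seminorms UNIV}) = Z_space"
    using topspace_Z_topology unfolding Z_topology_def .
  show "log_extension (\<lambda>x. f x - g x) = log_extension f - log_extension g" if "f \<in> Z_space" "g \<in> Z_space" for f g
    by (intro log_extension_diff Z that)
qed (use Z_space_diff in auto)

lemma log_extension_Zplus: "(\<lambda>F. log_extension (\<lambda>x. F (exp x))) \<in> antidual Zplus_topology"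
proof -
  have "continuous_map Zplus_topology euclidean (log_extension \<circ> (\<lambda>F x. F (exp x)))"
    unfolding Zplus_topology_def by (rule continuous_map_pullback[OF log_extension_Z_continuous])
  moreover have "(\<lambda>x. F (exp x)) \<in> schwartz_space" if "F \<in> Zplus_space" for F
    using that Z_space_subset by (auto simp: Zplus_space_def)
  ultimately show ?thesis
    unfolding antidual_iff by (simp add: o_def log_extension_add log_extension_cmult)
qed

end

theorem theorem3p8:
  fixes h :: "(real \<Rightarrow> complex) \<Rightarrow> complex"
  assumes "h \<in> antidual (test_topology {0<..})"
    and "\<exists>C. \<forall>f\<in>test_space {0<..}.
           cmod (h (laplace_conv (\<lambda>s. cnj (f s)) f)) \<le> C * (l2norm_pos f)\<^sup>2"
  shows "(\<forall>\<kappa>>2. \<exists>C. \<forall>F\<in>test_space {0<..}.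
            cmod (h F) \<le> C * (\<Sum>n\<le>2. SUP t\<in>{0<..}. (1 + \<bar>ln t\<bar>) powr \<kappa> * t ^ n * cmod (nderiv n F t))) \<and>
         (\<exists>\<Theta>\<in>antidual schwartz_topology.
            (\<forall>\<Omega>\<in>test_space UNIV. \<Theta> \<Omega> = log_dist h \<Omega>) \<and>
            (\<lambda>F. \<Theta> (\<lambda>x. F (exp x))) \<in> antidual Zplus_topology)"
proof -
  obtain C where C: "\<And>f. f \<in> test_space {0<..} \<Longrightarrow>
      cmod (h (laplace_conv (\<lambda>s. cnj (f s)) f)) \<le> C * (l2norm_pos f)\<^sup>2"
    using assms(2) by blast
  \<comment> \<open>The given constant may have either sign; its absolute value satisfies the
    nonnegativity required by the locale.\<close>
  interpret hankel_form h "\<bar>C\<bar>"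
  proof
    fix f :: "real \<Rightarrow> complex" assume "f \<in> test_space {0<..}"
    from C[OF this] show "cmod (h (laplace_conv (\<lambda>s. cnj (f s)) f)) \<le> \<bar>C\<bar> * (l2norm_pos f)\<^sup>2"
      by (rule order_trans) (simp add: mult_right_mono)
  qed (use assms(1) in auto)
  show ?thesis
    using weighted_sup_bound log_extension_antidual log_extension_log_dist log_extension_Zplus by blast
qed

end
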